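(* Let $n\ge2$ and $n=2k$, and let $(\mathbb{R}^n,\delta_{ij}\varphi^{-2})$ be a steady gradient $k$-Yamabe soliton with $f$ as potential function, where $\delta=\sum_{i=1}^n\varepsilon_i\,dx_i\otimes dx_i$, $\varepsilon_i=\pm1$, is the pseudo-Euclidean metric. Then $\varphi$ and $f$ are invariant under an $(n-1)$-dimensional translation group whose basic invariant is $\xi=\sum\alpha_ix_i$ and $\alpha=\sum_{i=1}^n\alpha_i\frac{\partial}{\partial x_i}$ is a space-like or time-like vector if, and only if, $\varphi$ and $f$ satisfy: (a) In the case $\varphi'=0$, $$\varphi(\xi)=c_1,\qquad f(\xi)=c\,\xi+d,\qquad c,d\in\mathbb{R},\quad c_1\in(0,\infty).$$ (b) In the case $\varphi'\neq0$, $$f(\xi)=\int\frac{c}{\varphi^2(\xi)}\,d\xi+d,\qquad c,d\in\mathbb{R},$$ and $$\int\frac{d\varphi}{\sqrt[n-1]{\dfrac{c}{b_{n,k}n^2\varphi}+c_1\varphi^{n-1}}}=\xi+c_2,\qquad c_1,c_2\in\mathbb{R},$$ where $$b_{n,k}=\frac{(n-1)!}{k!(n-k)!}(-1)^{k-1}\frac1{2^{k-1}}.$$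
   Context: A pseudo-Riemannian manifold $(M^n,g)$ is a gradient $k$-Yamabe soliton ($1\le k\le n$) if there are a constant $\lambda\in\mathbb{R}$ (the soliton constant) and a function $f\in C^\infty(M)$ (the potential function) with $\nabla^2 f=2(n-1)(\sigma_k-\lambda)g$, where $\nabla^2 f$ is the Hessian of $f$ with respect to $g$ and $\sigma_k$ is the $k$-th elementary symmetric function of the eigenvalues of $g^{-1}A_g$. Here $A_g=\frac1{n-2}\left[Ric_g-\frac{scal_g}{2(n-1)}g\right]$ is the Schouten tensor; for a conformal metric $g=\delta/\varphi^2$ it is computed as $A_g=\frac{\nabla^2_\delta\varphi}{\varphi}-\frac{|\nabla_\delta\varphi|^2}{2\varphi^2}\delta$. The soliton is steady if $\lambda=0$. The conformal factor $\varphi$ is a positive smooth function. Invariance under the translation group with basic invariant $\xi$ means that $\varphi=\varphi(\xi)$ and $f=f(\xi)$ are functions of $\xi$ only; primes denote derivatives with respect to $\xi$. The vector $\alpha$ is space-like or time-like when $\|\alpha\|^2=\sum_i\varepsilon_i\alpha_i^2\neq0$. The integrals are antiderivatives, so the second formula in (b) determines $\varphi$ implicitly as a function of $\xi$. *)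

theory Defs
  imports "HOL-Analysis.Analysis" "HOL-Computational_Algebra.Polynomial"
begin

section \<open>Calculus in the global coordinates of the real vector space\<close>

definition partial :: "'n::finite \<Rightarrow> (real^'n \<Rightarrow> real) \<Rightarrow> real^'n \<Rightarrow> real" where
  "partial i f x = frechet_derivative f (at x) (axis i 1)"

text \<open>All iterated partial derivatives are differentiable (hence continuous), i.e. the
  function is infinitely often continuously differentiable.\<close>

definition smooth :: "(real^'n::finite \<Rightarrow> real) \<Rightarrow> bool" where
  "smooth f \<longleftrightarrow> (\<forall>is x. foldr partial is f differentiable (at x))"


section \<open>Curvature of a pseudo-Riemannian metric, given by its matrix in coordinates\<close>

definition christoffel ::
    "(real^'n \<Rightarrow> real^'n^'n) \<Rightarrow> 'n::finite \<Rightarrow> 'n \<Rightarrow> 'n \<Rightarrow> real^'n \<Rightarrow> real" where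
  "christoffel g k i j x = (1/2) * (\<Sum>l\<in>UNIV. matrix_inv (g x) $ k $ l *
      (partial i (\<lambda>y. g y $ j $ l) x + partial j (\<lambda>y. g y $ i $ l) x
        - partial l (\<lambda>y. g y $ i $ j) x))"

definition hessian :: "(real^'n \<Rightarrow> real^'n^'n) \<Rightarrow> (real^'n::finite \<Rightarrow> real) \<Rightarrow> real^'n \<Rightarrow> real^'n^'n" where
  "hessian g f x = (\<chi> i j. partial i (partial j f) x
      - (\<Sum>k\<in>UNIV. christoffel g k i j x * partial k f x))"

text \<open>The sign convention is the one for which round spheres have positive Ricci curvature.\<close>

definition ricci :: "(real^'n \<Rightarrow> real^'n^'n) \<Rightarrow> real^'n::finite \<Rightarrow> real^'n^'n" where
  "ricci g x = (\<chi> i j.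
      (\<Sum>k\<in>UNIV. partial k (christoffel g k i j) x - partial j (christoffel g k i k) x)
      + (\<Sum>k\<in>UNIV. \<Sum>l\<in>UNIV. christoffel g k k l x * christoffel g l i j x
                             - christoffel g k j l x * christoffel g l i k x))"

definition scalar_curvature :: "(real^'n \<Rightarrow> real^'n^'n) \<Rightarrow> real^'n::finite \<Rightarrow> real" where
  "scalar_curvature g x = trace (matrix_inv (g x) ** ricci g x)"

definition schouten :: "(real^'n \<Rightarrow> real^'n^'n) \<Rightarrow> real^'n::finite \<Rightarrow> real^'n^'n" where
  "schouten g x = (1 / (real CARD('n) - 2)) *\<^sub>R
      (ricci g x - (scalar_curvature g x / (2 * (real CARD('n) - 1))) *\<^sub>R g x)"


section \<open>Metrics conformal to a pseudo-Euclidean metric\<close>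

text \<open>The signature is given by \<open>\<epsilon>\<close>, with every \<open>\<epsilon> i\<close> equal to 1 or -1.\<close>

definition flat_metric :: "('n \<Rightarrow> real) \<Rightarrow> real^'n::finite^'n" where
  "flat_metric \<epsilon> = (\<chi> i j. if i = j then \<epsilon> i else 0)"

definition flat_norm2 :: "('n \<Rightarrow> real) \<Rightarrow> real^'n::finite \<Rightarrow> real" where
  "flat_norm2 \<epsilon> v = (\<Sum>i\<in>UNIV. \<epsilon> i * (v $ i)\<^sup>2)"

definition conf_metric :: "('n \<Rightarrow> real) \<Rightarrow> (real^'n \<Rightarrow> real) \<Rightarrow> real^'n::finite \<Rightarrow> real^'n^'n" where
  "conf_metric \<epsilon> \<phi> x = (1 / (\<phi> x)\<^sup>2) *\<^sub>R flat_metric \<epsilon>"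

text \<open>In dimension 2 the factor \<open>1 / (n - 2)\<close> in the definition of the Schouten tensor is
  meaningless. There the Schouten tensor of \<open>\<delta> / \<phi>\<^sup>2\<close> is, by convention, given by the expression
  \<open>\<nabla>\<^sup>2\<phi> / \<phi> - |\<nabla>\<phi>|\<^sup>2 / (2 \<phi>\<^sup>2) \<delta>\<close> (all operations with respect to \<open>\<delta>\<close>), which is what the
  Schouten tensor of \<open>\<delta> / \<phi>\<^sup>2\<close> is equal to in every dimension above 2. In \<open>flat_norm2\<close> below the
  covector \<open>d\<phi>\<close> replaces the gradient: their squared norms agree since \<open>1 / \<epsilon> i = \<epsilon> i\<close>.\<close>

definition conf_schouten ::
    "('n \<Rightarrow> real) \<Rightarrow> (real^'n \<Rightarrow> real) \<Rightarrow> real^'n::finite \<Rightarrow> real^'n^'n" where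
  "conf_schouten \<epsilon> \<phi> x =
     (if CARD('n) = 2
      then (1 / \<phi> x) *\<^sub>R (\<chi> i j. partial i (partial j \<phi>) x)
        - (flat_norm2 \<epsilon> (\<chi> i. partial i \<phi> x) / (2 * (\<phi> x)\<^sup>2)) *\<^sub>R flat_metric \<epsilon>
      else schouten (conf_metric \<epsilon> \<phi>) x)"


section \<open>Elementary symmetric functions of the eigenvalues\<close>

definition charpoly :: "'a::comm_ring_1^'n::finite^'n \<Rightarrow> 'a poly" where
  "charpoly A = det (\<chi> i j. (if i = j then [:0, 1:] else 0) - [:A $ i $ j:])"

text \<open>In indefinite signature \<open>g\<inverse> A\<close> need not have real eigenvalues, so these are taken in the
  complex numbers, with algebraic multiplicity. The order in the list is irrelevant.\<close>

definition eigenvalue_list :: "real^'n::finite^'n \<Rightarrow> complex list" where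
  "eigenvalue_list A =
     (SOME xs. mset xs = proots (charpoly (\<chi> i j. complex_of_real (A $ i $ j))))"

definition elem_sym :: "nat \<Rightarrow> 'a::comm_ring_1 list \<Rightarrow> 'a" where
  "elem_sym k xs = (\<Sum>S | S \<subseteq> {..<length xs} \<and> card S = k. \<Prod>i\<in>S. xs ! i)"

text \<open>The non-real eigenvalues of a real matrix come in conjugate pairs, so \<open>elem_sym\<close> is real here
  and taking the real part only changes the type.\<close>

definition sigma :: "nat \<Rightarrow> real^'n::finite^'n \<Rightarrow> real" where
  "sigma k A = Re (elem_sym k (eigenvalue_list A))"


section \<open>Gradient k-Yamabe solitons\<close>

definition gradient_Yamabe_soliton ::
    "nat \<Rightarrow> real \<Rightarrow> ('n \<Rightarrow> real) \<Rightarrow> (real^'n \<Rightarrow> real) \<Rightarrow> (real^'n::finite \<Rightarrow> real) \<Rightarrow> bool" where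
  "gradient_Yamabe_soliton k lam \<epsilon> \<phi> f \<longleftrightarrow>
     1 \<le> k \<and> k \<le> CARD('n) \<and> smooth f \<and>
     (\<forall>x. hessian (conf_metric \<epsilon> \<phi>) f x =
        (2 * (real CARD('n) - 1) *
          (sigma k (matrix_inv (conf_metric \<epsilon> \<phi> x) ** conf_schouten \<epsilon> \<phi> x) - lam))
        *\<^sub>R conf_metric \<epsilon> \<phi> x)"

abbreviation steady_gradient_Yamabe_soliton ::
    "nat \<Rightarrow> ('n \<Rightarrow> real) \<Rightarrow> (real^'n \<Rightarrow> real) \<Rightarrow> (real^'n::finite \<Rightarrow> real) \<Rightarrow> bool" where
  "steady_gradient_Yamabe_soliton k \<equiv> gradient_Yamabe_soliton k 0"


section \<open>Translation invariance and the explicit solutions\<close>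

definition basic_invariant :: "real^'n::finite \<Rightarrow> real^'n \<Rightarrow> real" where
  "basic_invariant \<alpha> x = (\<Sum>i\<in>UNIV. \<alpha> $ i * x $ i)"

definition translation_invariant :: "real^'n::finite \<Rightarrow> (real^'n \<Rightarrow> real) \<Rightarrow> bool" where
  "translation_invariant \<alpha> h \<longleftrightarrow> (\<exists>H. \<forall>x. h x = H (basic_invariant \<alpha> x))"

definition b_coeff :: "nat \<Rightarrow> nat \<Rightarrow> real" where
  "b_coeff n k = fact (n - 1) / (fact k * fact (n - k)) * (-1) ^ (k - 1) * (1 / 2 ^ (k - 1))"

text \<open>The following two predicates concern the profiles \<open>\<Phi>\<close>, \<open>F\<close> with \<open>\<phi> = \<Phi> \<circ> \<xi>\<close>, \<open>f = F \<circ> \<xi>\<close>.\<close>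

definition constant_solution :: "(real \<Rightarrow> real) \<Rightarrow> (real \<Rightarrow> real) \<Rightarrow> bool" where
  "constant_solution \<Phi> F \<longleftrightarrow>
     (\<forall>t. deriv \<Phi> t = 0) \<and>
     (\<exists>c d c1. c1 > 0 \<and> (\<forall>t. \<Phi> t = c1) \<and> (\<forall>t. F t = c * t + d))"

text \<open>\<open>P\<close> is the antiderivative in the formula for \<open>f\<close>, and \<open>Q\<close> the one (with respect to the
  variable \<open>\<phi>\<close>, on the range of \<open>\<Phi>\<close>) in the implicit equation for \<open>\<phi>\<close>. Both formulas share the
  constant \<open>c\<close>. Since \<open>n\<close> is even in the application, \<open>root (n - 1)\<close> is the odd real root, which
  is defined for negative radicands as well.\<close>

definition nonconstant_solution :: "nat \<Rightarrow> nat \<Rightarrow> (real \<Rightarrow> real) \<Rightarrow> (real \<Rightarrow> real) \<Rightarrow> bool" where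
  "nonconstant_solution n k \<Phi> F \<longleftrightarrow>
     (\<forall>t. deriv \<Phi> t \<noteq> 0) \<and>
     (\<exists>c d c1 c2.
        (\<exists>P. \<forall>t. (P has_real_derivative c / (\<Phi> t)\<^sup>2) (at t) \<and> F t = P t + d) \<and>
        (let R = (\<lambda>u. c / (b_coeff n k * (real n)\<^sup>2 * u) + c1 * u ^ (n - 1))
         in \<exists>Q. \<forall>t. R (\<Phi> t) \<noteq> 0 \<and>
              (Q has_real_derivative 1 / root (n - 1) (R (\<Phi> t))) (at (\<Phi> t)) \<and>
              Q (\<Phi> t) = t + c2))"

end

theory Submission
  imports Defs
begin

text \<open>
  One implication is immediate, as the profiles \<open>\<Phi>\<close> and \<open>F\<close> exhibit \<open>\<phi>\<close> and \<open>f\<close> as functions of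
  \<open>\<xi> = \<Sum>i. \<alpha>\<^sub>i x\<^sub>i\<close>. For the other one let \<open>\<phi> = \<Phi> \<circ> \<xi>\<close> and \<open>f = F \<circ> \<xi>\<close>; a function of this form is
  called a ridge function below, and \<open>\<Phi>\<close> its profile. Put \<open>N = flat_norm2 \<epsilon> \<alpha>\<close> and \<open>u = \<Phi>' / \<Phi>\<close>.

  The metric depends on \<open>\<xi>\<close> only. Its Christoffel symbols are \<open>- u\<close> times a constant tensor built
  from \<open>\<alpha>\<close> and \<open>\<epsilon>\<close>, and contracting that tensor yields
  \<open>\<nabla>\<^sup>2f = (F'' + 2 u F') \<alpha> \<alpha>\<^sup>T - N u F' \<delta>\<close> (\<open>hessian_ridge\<close>) and the Schouten tensor
  \<open>(u' + u\<^sup>2) \<alpha> \<alpha>\<^sup>T - N u\<^sup>2 / 2 \<delta>\<close> (\<open>conf_schouten_ridge\<close>). The latter is, up to the metric, a rank one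
  perturbation of a multiple of the identity, whose eigenvalues follow from a determinant formula
  (\<open>det_rank_one_update\<close>). For \<open>n = 2 k\<close> this gives
  \<open>\<sigma>\<^sub>k = k b N\<^sup>k \<Phi>\<^sup>n u\<^bsup>n-2\<^esup> u'\<close>, where \<open>b = b_coeff n k\<close> (\<open>sigma_conf_schouten_ridge\<close>).

  In the soliton equation the coefficients of \<open>\<alpha> \<alpha>\<^sup>T\<close> and of \<open>\<delta>\<close> vanish separately
  (\<open>steady_ridge_soliton_equations\<close>). The first one says \<open>(F' \<Phi>\<^sup>2)' = 0\<close>, hence \<open>F' = c / \<Phi>\<^sup>2\<close>. With
  this the second one becomes \<open>(n - 1) u\<^bsup>n-2\<^esup> u' = - n A u / \<Phi>\<^sup>n\<close>, where \<open>A = c / (n\<^sup>2 b N\<^bsup>k-1\<^esup>)\<close>, and it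
  integrates to \<open>u\<^bsup>n-1\<^esup> = A / \<Phi>\<^sup>n + c1\<close> (\<open>profile_first_integral\<close>). Multiplied by \<open>\<Phi>\<^bsup>n-1\<^esup>\<close>, this is the
  implicit formula for \<open>\<Phi>\<close> after separation of variables, except for two points.

  The solution must be constant or have \<open>\<Phi>' \<noteq> 0\<close> everywhere, and the factor \<open>N\<^bsup>k-1\<^esup>\<close> does not occur
  in the formula to be proved. Both points are settled by \<open>profile_dichotomy\<close>. If \<open>n = 2\<close>, the factor
  is 1, and \<open>u \<Phi>\<^sup>2\<close> solves a homogeneous linear equation, so it vanishes everywhere or nowhere. If
  \<open>A = 0\<close>, then \<open>c = 0\<close>, and \<open>u\<close> is constant. In the remaining case, \<open>n > 2\<close> and \<open>A \<noteq> 0\<close>, it is decisive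
  that the solution is defined on the whole line. A nonconstant one cannot be continued for all times:
  in one time direction \<open>\<Phi>\<close> reaches 0, or \<open>u\<close> reaches 0 in a way that contradicts the continuity of
  \<open>u'\<close>. Hence \<open>\<Phi>\<close> is constant there.
\<close>

section \<open>Ridge functions\<close>

lemma basic_invariant_has_derivative:
  "((basic_invariant \<alpha>) has_derivative basic_invariant \<alpha>) (at x)"
proof -
  have "bounded_linear (basic_invariant \<alpha>)"
    unfolding basic_invariant_def
    by (intro bounded_linear_sum bounded_linear_const_mult bounded_linear_vec_nth)
  then show ?thesis by (rule bounded_linear_imp_has_derivative)
qed

lemma basic_invariant_axis [simp]: "basic_invariant \<alpha> (axis i 1) = \<alpha> $ i"
  by (simp add: basic_invariant_def axis_def if_distrib cong: if_cong)

lemma basic_invariant_section: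
  assumes "\<alpha> \<noteq> 0"
  shows "basic_invariant \<alpha> ((t / (\<alpha> \<bullet> \<alpha>)) *\<^sub>R \<alpha>) = t"
proof -
  have "basic_invariant \<alpha> ((t / (\<alpha> \<bullet> \<alpha>)) *\<^sub>R \<alpha>) = \<alpha> \<bullet> ((t / (\<alpha> \<bullet> \<alpha>)) *\<^sub>R \<alpha>)"
    by (simp add: basic_invariant_def inner_vec_def)
  then show ?thesis using assms by simp
qed

text \<open>By the chain rule every partial derivative of a ridge function is again a ridge function; this is
what turns all tensors below into expressions in \<open>\<alpha>\<close> with coefficients that are functions of one
variable.\<close>

lemma partial_ridge:
  assumes "(H has_real_derivative D) (at (basic_invariant \<alpha> x))"
  shows "partial i (\<lambda>y. H (basic_invariant \<alpha> y)) x = \<alpha> $ i * D"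
proof -
  have "((\<lambda>y. H (basic_invariant \<alpha> y)) has_derivative
          (\<lambda>v. D * basic_invariant \<alpha> v)) (at x)"
    using has_derivative_compose[OF basic_invariant_has_derivative
        assms[unfolded has_field_derivative_def]] .
  then have "frechet_derivative (\<lambda>y. H (basic_invariant \<alpha> y)) (at x) = (\<lambda>v. D * basic_invariant \<alpha> v)"
    by (rule frechet_derivative_at[symmetric])
  then show ?thesis by (simp add: partial_def)
qed

text \<open>Restricting to the line through \<open>\<alpha>\<close> recovers the profile \<open>H\<close>, so regularity passes from the
function on the space to its profile.\<close>

lemma ridge_profile_differentiable:
  assumes "\<alpha> \<noteq> 0" and h: "\<And>x. (\<lambda>y. H (basic_invariant \<alpha> y)) differentiable (at x)"
  shows "H differentiable (at t)"
proof -
  have "(\<lambda>s. (\<lambda>y. H (basic_invariant \<alpha> y)) ((s / (\<alpha> \<bullet> \<alpha>)) *\<^sub>R \<alpha>)) differentiable (at t)"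
    using assms(1)
    by (intro differentiable_compose[where f = "\<lambda>y. H (basic_invariant \<alpha> y)", OF h])
       (auto intro!: derivative_intros)
  then show ?thesis by (simp add: basic_invariant_section[OF assms(1)])
qed

text \<open>Differentiating repeatedly in one coordinate direction with \<open>\<alpha> $ i \<noteq> 0\<close> gives a nonzero multiple
of the iterated derivative of the profile.\<close>

lemma smooth_ridge_profile:
  assumes "\<alpha> \<noteq> 0" and "smooth (\<lambda>y. H (basic_invariant \<alpha> y))"
  shows "(deriv ^^ m) H differentiable (at t)"
proof -
  obtain i where i: "\<alpha> $ i \<noteq> 0" using assms(1) by (metis vec_eq_iff zero_index)
  have "(\<forall>x. foldr partial (replicate m i) (\<lambda>y. H (basic_invariant \<alpha> y)) x
            = (\<alpha> $ i) ^ m * (deriv ^^ m) H (basic_invariant \<alpha> x))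
        \<and> (\<forall>t. (deriv ^^ m) H differentiable (at t))"
  proof (induction m)
    case 0
    have "\<And>x. (\<lambda>y. H (basic_invariant \<alpha> y)) differentiable (at x)"
      using assms(2)[unfolded smooth_def, rule_format, of "[]"] by simp
    then have "H differentiable (at t)" for t
      by (rule ridge_profile_differentiable[OF assms(1)])
    then show ?case by simp
  next
    case (Suc m)
    let ?G = "(deriv ^^ m) H"
    have eq: "foldr partial (replicate m i) (\<lambda>y. H (basic_invariant \<alpha> y))
        = (\<lambda>x. (\<alpha> $ i) ^ m * ?G (basic_invariant \<alpha> x))"
      using Suc by blast
    have d: "(?G has_real_derivative deriv ?G t) (at t)" for t
      using Suc by (metis DERIV_deriv_iff_real_differentiable)
    have 1: "foldr partial (replicate (Suc m) i) (\<lambda>y. H (basic_invariant \<alpha> y))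
        = (\<lambda>x. (\<alpha> $ i) ^ Suc m * (deriv ^^ Suc m) H (basic_invariant \<alpha> x))"
    proof
      fix x
      have "((\<lambda>t. (\<alpha> $ i) ^ m * ?G t) has_real_derivative (\<alpha> $ i) ^ m * deriv ?G (basic_invariant \<alpha> x))
          (at (basic_invariant \<alpha> x))"
        by (intro DERIV_cmult d)
      from partial_ridge[OF this, of i]
      show "foldr partial (replicate (Suc m) i) (\<lambda>y. H (basic_invariant \<alpha> y)) x
        = (\<alpha> $ i) ^ Suc m * (deriv ^^ Suc m) H (basic_invariant \<alpha> x)"
        by (simp add: eq[simplified] mult_ac)
    qed
    have "(\<lambda>x. (\<alpha> $ i) ^ Suc m * (deriv ^^ Suc m) H (basic_invariant \<alpha> x)) differentiable (at x)" for x
      using assms(2)[unfolded smooth_def, rule_format, of "replicate (Suc m) i" x] unfolding 1 .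
    then have "(\<lambda>x. (1 / (\<alpha> $ i) ^ Suc m) * ((\<alpha> $ i) ^ Suc m * (deriv ^^ Suc m) H (basic_invariant \<alpha> x)))
        differentiable (at x)" for x
      by (rule differentiable_mult[OF differentiable_const])
    moreover have "(\<lambda>x. (1 / (\<alpha> $ i) ^ Suc m) * ((\<alpha> $ i) ^ Suc m * (deriv ^^ Suc m) H (basic_invariant \<alpha> x)))
        = (\<lambda>x. (deriv ^^ Suc m) H (basic_invariant \<alpha> x))"
      using i by simp
    ultimately have *: "(\<lambda>x. (deriv ^^ Suc m) H (basic_invariant \<alpha> x)) differentiable (at x)" for x
      by (simp only:)
    have "\<forall>t. (deriv ^^ Suc m) H differentiable (at t)"
      by (intro allI ridge_profile_differentiable[OF assms(1) *])
    with 1 show ?case by metis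
  qed
  then show ?thesis by blast
qed


section \<open>Christoffel symbols of a ridge metric\<close>

lemma matrix_inv_eqI:
  fixes A B :: "real^'n::finite^'n"
  assumes "A ** B = mat 1" "B ** A = mat 1"
  shows "matrix_inv A = B"
proof -
  have "A ** matrix_inv A = mat 1"
    using assms by (auto simp: matrix_inv_def intro: someI2)
  then have "B ** (A ** matrix_inv A) = B" by simp
  then show ?thesis using assms(2) by (simp add: matrix_mul_assoc)
qed

lemma matrix_inv_conf_metric:
  assumes "\<And>i. \<epsilon> i = 1 \<or> \<epsilon> i = -1" "\<phi> x \<noteq> 0"
  shows "matrix_inv (conf_metric \<epsilon> \<phi> x) = (\<phi> x)\<^sup>2 *\<^sub>R flat_metric \<epsilon>"
proof -
  have e: "\<epsilon> i * \<epsilon> i = 1" for i using assms(1)[of i] by auto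
  have *: "(if i = k then a else 0) * (if k = j then b else 0) = (if i = k then (if i = j then a * b else 0) else 0)"
    for i j k :: 'n and a b :: real by auto
  have "flat_metric \<epsilon> ** flat_metric \<epsilon> = mat 1"
    by (auto simp: flat_metric_def matrix_matrix_mult_def mat_def vec_eq_iff * e)
  then show ?thesis
    using assms(2) unfolding conf_metric_def
    by (intro matrix_inv_eqI)
      (simp_all add: scalar_matrix_assoc[symmetric] matrix_scalar_ac)
qed

text \<open>The constant tensor to which the Christoffel symbols of a ridge metric are proportional.\<close>

definition ridge_coeff :: "('n \<Rightarrow> real) \<Rightarrow> real^'n::finite \<Rightarrow> 'n \<Rightarrow> 'n \<Rightarrow> 'n \<Rightarrow> real" where
  "ridge_coeff \<epsilon> \<alpha> k i j = (if j = k then \<alpha> $ i else 0) + (if i = k then \<alpha> $ j else 0)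
     - (if i = j then \<epsilon> i * \<epsilon> k * \<alpha> $ k else 0)"

text \<open>The conformal factor enters only through its logarithmic derivative \<open>u\<close>.\<close>

lemma christoffel_ridge:
  assumes \<epsilon>: "\<And>i. \<epsilon> i = 1 \<or> \<epsilon> i = -1" and pos: "\<And>t. \<Phi> t > 0"
    and \<Phi>: "\<And>t. (\<Phi> has_real_derivative u t * \<Phi> t) (at t)"
  shows "christoffel (conf_metric \<epsilon> (\<lambda>x. \<Phi> (basic_invariant \<alpha> x))) k i j x
    = - u (basic_invariant \<alpha> x) * ridge_coeff \<epsilon> \<alpha> k i j"
proof -
  let ?t = "basic_invariant \<alpha> x"
  let ?g = "conf_metric \<epsilon> (\<lambda>x. \<Phi> (basic_invariant \<alpha> x))"
  have e: "\<epsilon> i * (\<epsilon> i * z) = z" for i z using \<epsilon>[of i] by auto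
  have g: "(\<lambda>y. ?g y $ a $ b)
     = (\<lambda>y. (\<lambda>t. (if a = b then \<epsilon> a else 0) / (\<Phi> t)\<^sup>2) (basic_invariant \<alpha> y))" for a b
    by (auto simp: conf_metric_def flat_metric_def)
  have d: "((\<lambda>t. c / (\<Phi> t)\<^sup>2) has_real_derivative - 2 * c * u t / (\<Phi> t)\<^sup>2) (at t)" for c t
    using pos[of t] by (auto intro!: derivative_eq_intros \<Phi> simp: field_simps power2_eq_square)
  have p: "partial m (\<lambda>y. ?g y $ a $ b) x
     = \<alpha> $ m * (- 2 * (if a = b then \<epsilon> a else 0) * u ?t / (\<Phi> ?t)\<^sup>2)" for m a b
    unfolding g by (rule partial_ridge[OF d])
  have inv: "matrix_inv (?g x) = (\<Phi> ?t)\<^sup>2 *\<^sub>R flat_metric \<epsilon>"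
    using pos[of ?t] by (intro matrix_inv_conf_metric \<epsilon>) simp
  have "christoffel ?g k i j x = 1/2 * (\<epsilon> k * (\<Phi> ?t)\<^sup>2 * (partial i (\<lambda>y. ?g y $ j $ k) x
     + partial j (\<lambda>y. ?g y $ i $ k) x - partial k (\<lambda>y. ?g y $ i $ j) x))"
  proof -
    have "matrix_inv (?g x) $ k $ l * z = (if k = l then \<epsilon> k * (\<Phi> ?t)\<^sup>2 * z else 0)" for l z
      by (simp add: inv flat_metric_def)
    then show ?thesis by (simp add: christoffel_def)
  qed
  also have "\<dots> = - u ?t * ridge_coeff \<epsilon> \<alpha> k i j"
    using pos[of ?t] \<epsilon>[of k] \<epsilon>[of i] unfolding p
    by (auto simp: ridge_coeff_def field_simps e)
  finally show ?thesis .
qed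

text \<open>The contractions of the constant tensor that occur in the Hessian and in the Ricci tensor. The last
one, which is quadratic, is obtained by contracting one factor against an arbitrary vector: this
reduces it to contractions that are linear in the tensor.\<close>

lemma sum_ridge_coeff:
  fixes \<alpha> :: "real^'n::finite"
  assumes \<epsilon>: "\<And>i. \<epsilon> i = 1 \<or> \<epsilon> i = -1"
  shows "(\<Sum>k\<in>UNIV. \<alpha> $ k * ridge_coeff \<epsilon> \<alpha> k i j)
           = 2 * \<alpha> $ i * \<alpha> $ j - (if i = j then \<epsilon> i * flat_norm2 \<epsilon> \<alpha> else 0)" (is ?A)
    and "(\<Sum>k\<in>UNIV. ridge_coeff \<epsilon> \<alpha> k k j) = real CARD('n) * \<alpha> $ j" (is ?B)
    and "(\<Sum>k\<in>UNIV. ridge_coeff \<epsilon> \<alpha> k i k) = real CARD('n) * \<alpha> $ i" (is ?C)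
    and "(\<Sum>k\<in>UNIV. \<Sum>l\<in>UNIV. ridge_coeff \<epsilon> \<alpha> k j l * ridge_coeff \<epsilon> \<alpha> l i k)
           = (real CARD('n) + 2) * \<alpha> $ i * \<alpha> $ j
             - (if i = j then 2 * \<epsilon> i * flat_norm2 \<epsilon> \<alpha> else 0)" (is ?D)
proof -
  have ee: "\<epsilon> i * \<epsilon> i = 1" for i using \<epsilon>[of i] by auto
  have e: "\<epsilon> i * (\<epsilon> i * z) = z" for i z using \<epsilon>[of i] by auto
  have e2: "\<epsilon> i * (a * (\<epsilon> i * b)) = a * b" for i a b using \<epsilon>[of i] by auto
  have N: "(\<Sum>k\<in>UNIV. \<alpha> $ k * (\<epsilon> i * \<epsilon> k * \<alpha> $ k)) = \<epsilon> i * flat_norm2 \<epsilon> \<alpha>" for i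
    by (simp add: flat_norm2_def sum_distrib_left power2_eq_square mult_ac)
  have dl: "(a::real) * (if P then b else 0) = (if P then a * b else 0)"
     "(if P then b else 0) * a = (if P then b * a else 0)" for P a b by auto
  show ?A by (simp add: ridge_coeff_def algebra_simps sum.distrib sum_subtractf dl)
     (simp add: N[simplified mult_ac] mult_ac)
  show ?B by (simp add: ridge_coeff_def sum.distrib sum_subtractf ee e dl)
  show ?C by (simp add: ridge_coeff_def sum.distrib sum_subtractf ee e dl)
  have contract: "(\<Sum>l\<in>UNIV. ridge_coeff \<epsilon> \<alpha> k j l * X l)
      = \<alpha> $ j * X k + (if j = k then \<Sum>l\<in>UNIV. \<alpha> $ l * X l else 0) - \<epsilon> j * \<epsilon> k * \<alpha> $ k * X j" for k and X :: "'n \<Rightarrow> real"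
    by (simp add: ridge_coeff_def algebra_simps sum.distrib sum_subtractf dl)
  have last: "(\<Sum>k\<in>UNIV. \<epsilon> k * \<alpha> $ k * ridge_coeff \<epsilon> \<alpha> j i k) = (if i = j then flat_norm2 \<epsilon> \<alpha> else 0)"
    by (simp add: ridge_coeff_def algebra_simps sum.distrib sum_subtractf dl flat_norm2_def power2_eq_square e)
  have "(\<Sum>k\<in>UNIV. \<Sum>l\<in>UNIV. ridge_coeff \<epsilon> \<alpha> k j l * ridge_coeff \<epsilon> \<alpha> l i k)
     = \<alpha> $ j * (\<Sum>k\<in>UNIV. ridge_coeff \<epsilon> \<alpha> k i k) + (\<Sum>l\<in>UNIV. \<alpha> $ l * ridge_coeff \<epsilon> \<alpha> l i j)
       - \<epsilon> j * (\<Sum>k\<in>UNIV. \<epsilon> k * \<alpha> $ k * ridge_coeff \<epsilon> \<alpha> j i k)"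
    unfolding contract by (simp add: sum.distrib sum_subtractf sum_distrib_left mult_ac)
  then show ?D
    unfolding \<open>?A\<close> \<open>?C\<close> last by (auto simp: algebra_simps)
qed


section \<open>Rank one perturbations of a multiple of the identity\<close>

text \<open>Expanding the replaced row \<open>w\<close> in the standard basis, only its component at \<open>a\<close> survives: for any
other \<open>j\<close> the row \<open>e\<^sub>j\<close> in position \<open>a\<close> is proportional to the row in position \<open>j\<close>.\<close>

lemma det_rows_axis_replace_row:
  fixes w :: "'a::comm_ring_1^'n::finite"
  shows "det (\<chi> i. if i = a then w else axis i s) = s ^ (CARD('n) - 1) * w $ a"
proof -
  have w: "w = (\<Sum>j\<in>UNIV. w $ j *s axis j 1)"
  proof -
    have "w $ j * (if i = j then 1 else 0) = (if j = i then w $ i else 0)" for i j by auto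
    then show ?thesis by (simp add: vec_eq_iff axis_def)
  qed
  have off: "det (\<chi> i. if i = a then axis j 1 else axis i s :: 'a^'n^'n) = 0" if "j \<noteq> a" for j
  proof -
    have "(\<chi> i. if i = a then axis j 1 else axis i s :: 'a^'n^'n)
        = (\<chi> i. if i = j then s *s axis j 1 else if i = a then axis j 1 else axis i s)"
      using that by (auto simp: vec_eq_iff axis_def)
    moreover have "det (\<chi> i. if i = j then s *s axis j 1 else if i = a then axis j 1 else axis i s :: 'a^'n^'n)
      = s * det (\<chi> i. if i = j then axis j 1 else if i = a then axis j 1 else axis i s :: 'a^'n^'n)"
      by (rule det_row_mul)
    moreover have "det (\<chi> i. if i = j then axis j 1 else if i = a then axis j 1 else axis i s :: 'a^'n^'n) = 0"
      by (rule det_identical_rows[OF that]) (simp add: row_def vec_eq_iff)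
    ultimately show ?thesis by simp
  qed
  have diag: "det (\<chi> i. if i = a then axis a 1 else axis i s :: 'a^'n^'n) = s ^ (CARD('n) - 1)"
  proof -
    have "det (\<chi> i. if i = a then axis a 1 else axis i s :: 'a^'n^'n) = (\<Prod>i\<in>UNIV. if i = a then 1 else s)"
      by (subst det_diagonal) (auto simp: axis_def intro!: prod.cong)
    also have "\<dots> = (\<Prod>i\<in>UNIV - {a}. s)"
      by (subst prod.remove[of _ a]) (auto intro!: prod.cong)
    finally show ?thesis by (simp add: card_Diff_singleton)
  qed
  have "det (\<chi> i. if i = a then w else axis i s)
      = det (\<chi> i. if i = a then (\<Sum>j\<in>UNIV. w $ j *s axis j 1) else axis i s)"
    by (subst (1) w) (rule refl)
  also have "\<dots> = (\<Sum>j\<in>UNIV. det (\<chi> i. if i = a then w $ j *s axis j 1 else axis i s))"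
    by (rule det_linear_row_sum[where a = "\<lambda>_ j. w $ j *s axis j 1"]) simp
  also have "\<dots> = (\<Sum>j\<in>UNIV. w $ j * det (\<chi> i. if i = a then axis j 1 else axis i s))"
    by (intro sum.cong refl det_row_mul)
  also have "\<dots> = (\<Sum>j\<in>UNIV. if j = a then w $ j * s ^ (CARD('n) - 1) else 0)"
    using off diag by (intro sum.cong) auto
  finally show ?thesis by (simp add: mult.commute)
qed

text \<open>Once \<open>w\<close> itself is a row, multiples of \<open>w\<close> may be added to other rows without changing the
determinant.\<close>

lemma det_rank_one_update_replace_row:
  fixes w :: "'a::comm_ring_1^'n::finite"
  assumes "a \<notin> S"
  shows "det (\<chi> i. if i = a then w else if i \<in> S then axis i s + v i *s w else axis i s)
    = s ^ (CARD('n) - 1) * w $ a"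
  using finite[of S] assms
proof (induction S rule: finite_induct)
  case empty
  then show ?case using det_rows_axis_replace_row by (simp cong: if_cong)
next
  case (insert b S)
  let ?r = "\<lambda>i. if i = a then w else if i \<in> S then axis i s + v i *s w else axis i s"
  have ab: "a \<noteq> b" using insert by auto
  have "det (\<chi> i. if i = a then w else if i \<in> insert b S then axis i s + v i *s w else axis i s)
     = det (\<chi> i. if i = b then axis i s + v i *s w else ?r i)"
    using ab by (intro arg_cong[where f = det]) (auto simp: vec_eq_iff)
  also have "\<dots> = det (\<chi> i. if i = b then axis i s else ?r i) + det (\<chi> i. if i = b then v i *s w else ?r i)"
    by (rule det_row_add)
  also have "det (\<chi> i. if i = b then v i *s w else ?r i) = det (\<chi> i. if i = b then v b *s w else ?r i)"
    by (intro arg_cong[where f = det]) (auto simp: vec_eq_iff)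
  also have "\<dots> = v b * det (\<chi> i. if i = b then w else ?r i)"
    by (rule det_row_mul)
  also have "det (\<chi> i. if i = b then w else ?r i) = 0"
    using ab by (intro det_identical_rows[OF ab]) (auto simp: row_def vec_eq_iff)
  also have "det (\<chi> i. if i = b then axis i s else ?r i) = det (\<chi> i. ?r i)"
    using ab insert by (intro arg_cong[where f = det]) (auto simp: vec_eq_iff)
  finally show ?case using insert by simp
qed

text \<open>The determinant is linear in each row. Adding the multiples of \<open>w\<close> to the rows of \<open>s I\<close> one after
the other, each step contributes the determinant in which that row has been replaced by \<open>w\<close>; a
quadratic term in \<open>w\<close> never occurs, as it would come from two proportional rows. The argument uses
no division and therefore applies to the characteristic polynomial, whose entries are polynomials.\<close>

lemma det_rank_one_update:
  fixes v w :: "'a::comm_ring_1^'n::finite"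
  shows "det (\<chi> i j. (if i = j then s else 0) + v $ i * w $ j)
    = s ^ (CARD('n) - 1) * (s + (\<Sum>i\<in>UNIV. v $ i * w $ i))"
proof -
  have "det (\<chi> i. if i \<in> S then axis i s + v $ i *s w else axis i s)
    = s ^ CARD('n) + s ^ (CARD('n) - 1) * (\<Sum>i\<in>S. v $ i * w $ i)" for S
    using finite[of S]
  proof (induction S rule: finite_induct)
    case empty
    then show ?case by (subst det_diagonal) (auto simp: axis_def)
  next
    case (insert b S)
    let ?r = "\<lambda>i. if i \<in> S then axis i s + v $ i *s w else axis i s"
    have "det (\<chi> i. if i \<in> insert b S then axis i s + v $ i *s w else axis i s)
       = det (\<chi> i. if i = b then axis i s + v $ i *s w else ?r i)"
      by (intro arg_cong[where f = det]) (auto simp: vec_eq_iff)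
    also have "\<dots> = det (\<chi> i. if i = b then axis i s else ?r i) + det (\<chi> i. if i = b then v $ i *s w else ?r i)"
      by (rule det_row_add)
    also have "det (\<chi> i. if i = b then v $ i *s w else ?r i) = det (\<chi> i. if i = b then v $ b *s w else ?r i)"
      by (intro arg_cong[where f = det]) (auto simp: vec_eq_iff)
    also have "\<dots> = v $ b * det (\<chi> i. if i = b then w else ?r i)"
      by (rule det_row_mul)
    also have "det (\<chi> i. if i = b then w else ?r i) = s ^ (CARD('n) - 1) * w $ b"
      by (rule det_rank_one_update_replace_row) (use insert in auto)
    also have "det (\<chi> i. if i = b then axis i s else ?r i) = det (\<chi> i. ?r i)"
      using insert by (intro arg_cong[where f = det]) (auto simp: vec_eq_iff)
    finally show ?case using insert by (simp add: algebra_simps)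
  qed
  from this[of UNIV]
  have "det (\<chi> i. axis i s + v $ i *s w)
    = s ^ CARD('n) + s ^ (CARD('n) - 1) * (\<Sum>i\<in>UNIV. v $ i * w $ i)" by simp
  also have "(\<chi> i. axis i s + v $ i *s w) = (\<chi> i j. (if i = j then s else 0) + v $ i * w $ j)"
    by (auto simp: vec_eq_iff axis_def)
  also have "s ^ CARD('n) = s ^ (CARD('n) - 1) * s"
    by (rule power_minus_mult[symmetric]) simp
  finally show ?thesis by (simp add: algebra_simps)
qed

lemma eigenvalue_list_rank_one_update:
  fixes v w :: "real^'n::finite"
  shows "mset (eigenvalue_list (\<chi> i j. (if i = j then s else 0) + v $ i * w $ j))
    = add_mset (complex_of_real (s + (\<Sum>i\<in>UNIV. v $ i * w $ i)))
        (replicate_mset (CARD('n) - 1) (complex_of_real s))"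
proof -
  let ?A = "\<chi> i j. complex_of_real ((\<chi> i j. (if i = j then s else 0) + v $ i * w $ j) $ i $ j) :: complex^'n^'n"
  have "charpoly ?A = det (\<chi> i j. (if i = j then [:- complex_of_real s, 1:] else 0)
      + (\<chi> i. [:- complex_of_real (v $ i):]) $ i * (\<chi> j. [:complex_of_real (w $ j):]) $ j)"
    unfolding charpoly_def by (intro arg_cong[where f = det]) (auto simp: vec_eq_iff)
  also have "\<dots> = [:- complex_of_real s, 1:] ^ (CARD('n) - 1)
      * ([:- complex_of_real s, 1:] + (\<Sum>i\<in>UNIV. [:- complex_of_real (v $ i * w $ i):]))"
    unfolding det_rank_one_update by (simp add: mult.commute)
  also have "(\<Sum>i\<in>UNIV. [:- complex_of_real (v $ i * w $ i):]) = [:\<Sum>i\<in>UNIV. - complex_of_real (v $ i * w $ i):]"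
    by (simp add: poly_eq_iff coeff_sum coeff_pCons split: nat.split)
  finally have c: "charpoly ?A = [:- complex_of_real s, 1:] ^ (CARD('n) - 1)
      * [:- complex_of_real (s + (\<Sum>i\<in>UNIV. v $ i * w $ i)), 1:]"
    by (simp add: sum_negf)
  have "\<exists>xs. mset xs = proots (charpoly ?A)" by (rule ex_mset)
  then have "mset (eigenvalue_list (\<chi> i j. (if i = j then s else 0) + v $ i * w $ j)) = proots (charpoly ?A)"
    unfolding eigenvalue_list_def by (rule someI_ex)
  also have "\<dots> = add_mset (complex_of_real (s + (\<Sum>i\<in>UNIV. v $ i * w $ i)))
        (replicate_mset (CARD('n) - 1) (complex_of_real s))"
    unfolding c by (subst proots_mult) (simp_all add: proots_power repeat_mset_replicate_mset)
  finally show ?thesis .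
qed

text \<open>Splitting the index sets according to whether they contain the position of the exceptional entry
\<open>b\<close>. The two values \<open>a\<close> and \<open>b\<close> may coincide, so the position is fixed first and the multiset
equation then determines the entries at all the others.\<close>

lemma elem_sym_one_exception:
  fixes a b :: "'a::comm_ring_1"
  assumes "mset xs = add_mset b (replicate_mset m a)" "k \<ge> 1"
  shows "elem_sym k xs = of_nat (m choose k) * a ^ k + of_nat (m choose (k - 1)) * a ^ (k - 1) * b"
proof -
  have len: "length xs = Suc m" using assms(1) by (metis size_add_mset size_mset size_replicate_mset)
  have "b \<in> set xs" using assms(1) by (metis set_mset_mset union_single_eq_member)
  then obtain p where p: "p < length xs" "xs ! p = b" by (metis in_set_conv_nth)
  let ?I = "{..<length xs} - {p}"
  have "mset xs = image_mset ((!) xs) (mset_set {..<length xs})"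
    by (metis lessThan_atLeast0 map_nth mset_map mset_upt)
  also have "mset_set {..<length xs} = add_mset p (mset_set ?I)"
    using p by (metis finite_lessThan lessThan_iff mset_set.remove)
  finally have "image_mset ((!) xs) (mset_set ?I) = replicate_mset m a"
    using assms(1) p by simp
  then have "set_mset (image_mset ((!) xs) (mset_set ?I)) \<subseteq> {a}" by (simp add: set_mset_replicate_mset_subset)
  then have a: "xs ! i = a" if "i \<in> ?I" for i using that by auto
  have prod_a: "(\<Prod>i\<in>S. xs ! i) = a ^ card S" if "S \<subseteq> ?I" for S
    using a that by (subst prod_constant[symmetric], intro prod.cong) auto
  have cI: "card ?I = m" using p len by simp
  \<comment> \<open>Because of \<open>k \<ge> 1\<close>, the truncated subtraction \<open>k - 1\<close> is the cardinality after removing \<open>p\<close>.\<close>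
  have split: "{S. S \<subseteq> {..<length xs} \<and> card S = k}
      = {S. S \<subseteq> ?I \<and> card S = k} \<union> insert p ` {S. S \<subseteq> ?I \<and> card S = k - 1}" (is "?L = ?R")
  proof (intro equalityI subsetI)
    fix S assume S: "S \<in> ?L"
    then have fin: "finite S" using finite_subset by blast
    show "S \<in> ?R"
    proof (cases "p \<in> S")
      case True
      then have "S = insert p (S - {p})" "S - {p} \<in> {S. S \<subseteq> ?I \<and> card S = k - 1}"
        using S fin by auto
      then show ?thesis by blast
    qed (use S in auto)
  next
    fix S assume "S \<in> ?R"
    then show "S \<in> ?L"
    proof
      assume "S \<in> insert p ` {S. S \<subseteq> ?I \<and> card S = k - 1}"
      then obtain T where T: "S = insert p T" "T \<subseteq> ?I" "card T = k - 1" by auto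
      then have "finite T" "p \<notin> T" using finite_subset by auto
      then show ?thesis using T p assms(2) by auto
    qed auto
  qed
  have fin: "finite {S. S \<subseteq> ?I \<and> card S = l}" for l by simp
  have "elem_sym k xs = (\<Sum>S\<in>{S. S \<subseteq> ?I \<and> card S = k}. \<Prod>i\<in>S. xs ! i)
     + (\<Sum>S\<in>insert p ` {S. S \<subseteq> ?I \<and> card S = k - 1}. \<Prod>i\<in>S. xs ! i)"
    unfolding elem_sym_def split by (rule sum.union_disjoint) (use fin in auto)
  also have "(\<Sum>S\<in>{S. S \<subseteq> ?I \<and> card S = k}. \<Prod>i\<in>S. xs ! i) = (\<Sum>S\<in>{S. S \<subseteq> ?I \<and> card S = k}. a ^ k)"
    by (intro sum.cong) (auto simp: prod_a)
  also have "\<dots> = of_nat (m choose k) * a ^ k" by (simp add: n_subsets cI)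
  also have "(\<Sum>S\<in>insert p ` {S. S \<subseteq> ?I \<and> card S = k - 1}. \<Prod>i\<in>S. xs ! i)
     = (\<Sum>S\<in>{S. S \<subseteq> ?I \<and> card S = k - 1}. \<Prod>i\<in>insert p S. xs ! i)"
    by (rule sum.reindex[unfolded o_def]) (auto simp: inj_on_def)
  also have "\<dots> = (\<Sum>S\<in>{S. S \<subseteq> ?I \<and> card S = k - 1}. a ^ (k - 1) * b)"
  proof (intro sum.cong refl)
    fix S assume S: "S \<in> {S. S \<subseteq> ?I \<and> card S = k - 1}"
    then have "finite S" "p \<notin> S" using finite_subset by auto
    then show "(\<Prod>i\<in>insert p S. xs ! i) = a ^ (k - 1) * b"
      using S prod_a[of S] p by (simp add: mult.commute)
  qed
  also have "\<dots> = of_nat (m choose (k - 1)) * a ^ (k - 1) * b"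
    by (simp add: n_subsets cI mult.assoc)
  finally show ?thesis .
qed

lemma sigma_rank_one_update:
  fixes v w :: "real^'n::finite"
  assumes "k \<ge> 1"
  shows "sigma k (\<chi> i j. (if i = j then s else 0) + v $ i * w $ j)
    = real ((CARD('n) - 1) choose k) * s ^ k
      + real ((CARD('n) - 1) choose (k - 1)) * s ^ (k - 1) * (s + (\<Sum>i\<in>UNIV. v $ i * w $ i))"
proof -
  let ?N = "CARD('n) - 1" and ?t = "s + (\<Sum>i\<in>UNIV. v $ i * w $ i)"
  have "elem_sym k (eigenvalue_list (\<chi> i j. (if i = j then s else 0) + v $ i * w $ j))
      = of_nat (?N choose k) * complex_of_real s ^ k
        + of_nat (?N choose (k - 1)) * complex_of_real s ^ (k - 1) * complex_of_real ?t"
    by (rule elem_sym_one_exception[OF eigenvalue_list_rank_one_update assms])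
  also have "\<dots> = complex_of_real (real (?N choose k) * s ^ k + real (?N choose (k - 1)) * s ^ (k - 1) * ?t)"
    by simp
  finally show ?thesis by (simp only: sigma_def Re_complex_of_real)
qed


section \<open>Hessian and curvature of a ridge metric\<close>

lemma power_eq_power_diff_2_times_square:
  fixes x :: real
  assumes "n \<ge> 2"
  shows "x ^ n = x ^ (n - 2) * x\<^sup>2"
proof -
  have "x ^ n = x ^ (n - 2 + 2)" using assms by (simp only: le_add_diff_inverse2)
  then show ?thesis unfolding power_add .
qed

lemma hessian_ridge:
  fixes \<alpha> :: "real^'n::finite"
  assumes \<epsilon>: "\<And>i. \<epsilon> i = 1 \<or> \<epsilon> i = -1" and pos: "\<And>t. \<Phi> t > 0"
    and \<Phi>: "\<And>t. (\<Phi> has_real_derivative u t * \<Phi> t) (at t)"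
    and F: "\<And>t. (F has_real_derivative F' t) (at t)"
    and F': "\<And>t. (F' has_real_derivative F'' t) (at t)"
  defines "\<xi> \<equiv> basic_invariant \<alpha>"
  shows "hessian (conf_metric \<epsilon> (\<lambda>x. \<Phi> (\<xi> x))) (\<lambda>x. F (\<xi> x)) x
    = (\<chi> i j. (F'' (\<xi> x) + 2 * u (\<xi> x) * F' (\<xi> x)) * \<alpha> $ i * \<alpha> $ j
         - (if i = j then \<epsilon> i * flat_norm2 \<epsilon> \<alpha> * u (\<xi> x) * F' (\<xi> x) else 0))"
proof -
  have p1: "partial j (\<lambda>x. F (\<xi> x)) = (\<lambda>x. (\<alpha> $ j * F' (\<xi> x)))" for j
    unfolding \<xi>_def using partial_ridge[OF F] by blast
  have p2: "partial i (\<lambda>x. \<alpha> $ j * F' (\<xi> x)) x = \<alpha> $ i * (\<alpha> $ j * F'' (\<xi> x))" for i j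
    unfolding \<xi>_def by (rule partial_ridge) (rule DERIV_cmult[OF F'])
  have s: "(\<Sum>k\<in>UNIV. christoffel (conf_metric \<epsilon> (\<lambda>x. \<Phi> (\<xi> x))) k i j x * (\<alpha> $ k * F' (\<xi> x)))
     = - u (\<xi> x) * F' (\<xi> x) * (\<Sum>k\<in>UNIV. \<alpha> $ k * ridge_coeff \<epsilon> \<alpha> k i j)" for i j
    unfolding \<xi>_def christoffel_ridge[OF \<epsilon> pos \<Phi>]
    by (simp add: sum_distrib_left mult_ac sum_negf)
  show ?thesis
    unfolding hessian_def p1 p2 s sum_ridge_coeff[OF \<epsilon>]
    by (auto simp: vec_eq_iff algebra_simps)
qed

text \<open>Derivatives of the Christoffel symbols contribute the terms with \<open>u'\<close>, products of two of them
the terms with \<open>u\<^sup>2\<close>.\<close>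

lemma ricci_ridge:
  fixes \<alpha> :: "real^'n::finite"
  assumes \<epsilon>: "\<And>i. \<epsilon> i = 1 \<or> \<epsilon> i = -1" and pos: "\<And>t. \<Phi> t > 0"
    and \<Phi>: "\<And>t. (\<Phi> has_real_derivative u t * \<Phi> t) (at t)"
    and u: "\<And>t. (u has_real_derivative u' t) (at t)"
  defines "\<xi> \<equiv> basic_invariant \<alpha>"
  shows "ricci (conf_metric \<epsilon> (\<lambda>x. \<Phi> (\<xi> x))) x
    = (\<chi> i j. (real CARD('n) - 2) * (u' (\<xi> x) + (u (\<xi> x))\<^sup>2) * \<alpha> $ i * \<alpha> $ j
        + (if i = j then \<epsilon> i * flat_norm2 \<epsilon> \<alpha> * (u' (\<xi> x) - (real CARD('n) - 2) * (u (\<xi> x))\<^sup>2) else 0))"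
proof -
  let ?g = "conf_metric \<epsilon> (\<lambda>x. \<Phi> (\<xi> x))" and ?C = "ridge_coeff \<epsilon> \<alpha>"
  have chr: "christoffel ?g k i j = (\<lambda>x. - u (\<xi> x) * ?C k i j)" for k i j
    unfolding \<xi>_def by (intro ext christoffel_ridge \<epsilon> pos \<Phi>)
  have p: "partial m (\<lambda>x. - u (\<xi> x) * c) x = - u' (\<xi> x) * (\<alpha> $ m * c)" for m c
  proof -
    have "((\<lambda>t. - u t * c) has_real_derivative - u' (\<xi> x) * c) (at (basic_invariant \<alpha> x))"
      unfolding \<xi>_def by (auto intro!: derivative_eq_intros u)
    from partial_ridge[OF this, of m] show ?thesis by (simp add: \<xi>_def mult_ac)
  qed
  have linear_part: "(\<Sum>k\<in>UNIV. partial k (christoffel ?g k i j) x - partial j (christoffel ?g k i k) x)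
     = - u' (\<xi> x) * ((\<Sum>k\<in>UNIV. \<alpha> $ k * ?C k i j) - \<alpha> $ j * (\<Sum>k\<in>UNIV. ?C k i k))" for i j
    unfolding chr p by (simp add: sum_distrib_left sum_subtractf right_diff_distrib sum_negf)
  have quadratic_part: "(\<Sum>k\<in>UNIV. \<Sum>l\<in>UNIV. christoffel ?g k k l x * christoffel ?g l i j x
                             - christoffel ?g k j l x * christoffel ?g l i k x)
     = (u (\<xi> x))\<^sup>2 * (real CARD('n) * (\<Sum>l\<in>UNIV. \<alpha> $ l * ?C l i j)
         - (\<Sum>k\<in>UNIV. \<Sum>l\<in>UNIV. ?C k j l * ?C l i k))" for i j
  proof -
    have "(\<Sum>k\<in>UNIV. \<Sum>l\<in>UNIV. ?C k k l * ?C l i j) = (\<Sum>l\<in>UNIV. (\<Sum>k\<in>UNIV. ?C k k l) * ?C l i j)"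
      unfolding sum_distrib_right by (rule sum.swap)
    also have "\<dots> = real CARD('n) * (\<Sum>l\<in>UNIV. \<alpha> $ l * ?C l i j)"
      unfolding sum_ridge_coeff(2)[OF \<epsilon>] by (simp add: sum_distrib_left mult_ac)
    finally have "real CARD('n) * (\<Sum>l\<in>UNIV. \<alpha> $ l * ?C l i j) = (\<Sum>k\<in>UNIV. \<Sum>l\<in>UNIV. ?C k k l * ?C l i j)" ..
    then show ?thesis
      unfolding chr
      by (simp add: sum_subtractf[symmetric] sum_distrib_left power2_eq_square algebra_simps)
  qed
  show ?thesis
    unfolding ricci_def linear_part quadratic_part sum_ridge_coeff[OF \<epsilon>]
    by (auto simp: vec_eq_iff algebra_simps)
qed

lemma flat_metric_mult_nth: "(flat_metric \<epsilon> ** A) $ i $ j = \<epsilon> i * A $ i $ j"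
proof -
  have "flat_metric \<epsilon> $ i $ l * z = (if i = l then \<epsilon> i * z else 0)" for l z
    by (simp add: flat_metric_def)
  then show ?thesis by (simp add: matrix_matrix_mult_def)
qed

lemma trace_flat_metric_ridge:
  fixes \<alpha> :: "real^'n::finite"
  assumes \<epsilon>: "\<And>i. \<epsilon> i = 1 \<or> \<epsilon> i = -1"
  shows "trace (flat_metric \<epsilon> ** (\<chi> i j. p * \<alpha> $ i * \<alpha> $ j + (if i = j then \<epsilon> i * q else 0)))
    = p * flat_norm2 \<epsilon> \<alpha> + real CARD('n) * q"
proof -
  have e: "\<epsilon> i * (\<epsilon> i * z) = z" for i z using \<epsilon>[of i] by auto
  have ee: "\<epsilon> i * \<epsilon> i = 1" for i using \<epsilon>[of i] by auto
  show ?thesis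
    by (simp add: trace_def flat_metric_mult_nth flat_norm2_def sum.distrib sum_distrib_left
        distrib_left e ee power2_eq_square mult_ac)
qed

text \<open>In dimension two this is the convention built into the definition; in higher dimensions the factor
\<open>n - 2\<close> of the Ricci tensor cancels, and both cases have the same outcome.\<close>

lemma conf_schouten_ridge:
  fixes \<alpha> :: "real^'n::finite"
  assumes \<epsilon>: "\<And>i. \<epsilon> i = 1 \<or> \<epsilon> i = -1" and pos: "\<And>t. \<Phi> t > 0"
    and \<Phi>: "\<And>t. (\<Phi> has_real_derivative u t * \<Phi> t) (at t)"
    and u: "\<And>t. (u has_real_derivative u' t) (at t)"
    and n: "CARD('n) \<ge> 2"
  defines "\<xi> \<equiv> basic_invariant \<alpha>"
  shows "conf_schouten \<epsilon> (\<lambda>x. \<Phi> (\<xi> x)) x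
    = (\<chi> i j. (u' (\<xi> x) + (u (\<xi> x))\<^sup>2) * \<alpha> $ i * \<alpha> $ j
        - (if i = j then \<epsilon> i * flat_norm2 \<epsilon> \<alpha> * (u (\<xi> x))\<^sup>2 / 2 else 0))"
proof (cases "CARD('n) = 2")
  case True
  let ?t = "\<xi> x"
  have p1: "partial j (\<lambda>x. \<Phi> (\<xi> x)) = (\<lambda>x. (\<alpha> $ j * (u (\<xi> x) * \<Phi> (\<xi> x))))" for j
    unfolding \<xi>_def using partial_ridge[OF \<Phi>] by blast
  have p2: "partial i (\<lambda>x. \<alpha> $ j * (u (\<xi> x) * \<Phi> (\<xi> x))) x
      = \<alpha> $ i * (\<alpha> $ j * ((u' ?t + (u ?t)\<^sup>2) * \<Phi> ?t))" for i j
    unfolding \<xi>_def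
    by (rule partial_ridge)
       (auto intro!: derivative_eq_intros \<Phi> u simp: algebra_simps power2_eq_square)
  have "flat_norm2 \<epsilon> (\<chi> i. \<alpha> $ i * (u ?t * \<Phi> ?t)) = flat_norm2 \<epsilon> \<alpha> * (u ?t)\<^sup>2 * (\<Phi> ?t)\<^sup>2"
    by (simp add: flat_norm2_def sum_distrib_right sum_distrib_left power_mult_distrib mult_ac)
  then show ?thesis
    using True pos[of ?t] unfolding conf_schouten_def p1 p2
    by (auto simp: vec_eq_iff flat_metric_def field_simps)
next
  case False
  let ?n = "real CARD('n)" and ?t = "\<xi> x" and ?g = "conf_metric \<epsilon> (\<lambda>x. \<Phi> (\<xi> x)) x"
  define N where "N = flat_norm2 \<epsilon> \<alpha>"
  have n2: "?n > 2" using n False by linarith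
  have ric: "ricci (conf_metric \<epsilon> (\<lambda>x. \<Phi> (\<xi> x))) x
    = (\<chi> i j. ((?n - 2) * (u' ?t + (u ?t)\<^sup>2)) * \<alpha> $ i * \<alpha> $ j
        + (if i = j then \<epsilon> i * (N * (u' ?t - (?n - 2) * (u ?t)\<^sup>2)) else 0))"
    unfolding \<xi>_def ricci_ridge[OF \<epsilon> pos \<Phi> u] N_def by (simp add: mult.assoc cong: if_cong)
  have inv: "matrix_inv ?g = (\<Phi> ?t)\<^sup>2 *\<^sub>R flat_metric \<epsilon>"
    using pos[of ?t] by (intro matrix_inv_conf_metric \<epsilon>) simp
  have "scalar_curvature (conf_metric \<epsilon> (\<lambda>x. \<Phi> (\<xi> x))) x
     = (\<Phi> ?t)\<^sup>2 * trace (flat_metric \<epsilon> ** ricci (conf_metric \<epsilon> (\<lambda>x. \<Phi> (\<xi> x))) x)"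
    unfolding scalar_curvature_def inv
    by (simp add: scalar_matrix_assoc[symmetric] trace_def sum_distrib_left)
  also have "\<dots> = (\<Phi> ?t)\<^sup>2 * ((?n - 2) * (u' ?t + (u ?t)\<^sup>2) * N + ?n * (N * (u' ?t - (?n - 2) * (u ?t)\<^sup>2)))"
    unfolding ric trace_flat_metric_ridge[OF \<epsilon>] N_def ..
  also have "\<dots> = (?n - 1) * ((\<Phi> ?t)\<^sup>2 * N * (2 * u' ?t - (?n - 2) * (u ?t)\<^sup>2))"
    by (simp add: algebra_simps)
  finally have scal: "scalar_curvature (conf_metric \<epsilon> (\<lambda>x. \<Phi> (\<xi> x))) x / (2 * (?n - 1))
     = (\<Phi> ?t)\<^sup>2 * N * (2 * u' ?t - (?n - 2) * (u ?t)\<^sup>2) / 2"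
    using n2 by (simp add: field_simps)
  have g: "((\<Phi> ?t)\<^sup>2 * N * (2 * u' ?t - (?n - 2) * (u ?t)\<^sup>2) / 2) *\<^sub>R ?g
     = (N * (2 * u' ?t - (?n - 2) * (u ?t)\<^sup>2) / 2) *\<^sub>R flat_metric \<epsilon>"
    using pos[of ?t] by (simp add: conf_metric_def)
  have cancel: "(1 / (?n - 2)) * ((?n - 2) * P * a * b + (\<epsilon> i * (N * (u' ?t - (?n - 2) * U))
       - N * (2 * u' ?t - (?n - 2) * U) / 2 * \<epsilon> i)) = P * a * b - \<epsilon> i * N * U / 2" for P a b i U
  proof -
    have "(?n - 2) * P * a * b + (\<epsilon> i * (N * (u' ?t - (?n - 2) * U))
       - N * (2 * u' ?t - (?n - 2) * U) / 2 * \<epsilon> i) = (?n - 2) * (P * a * b - \<epsilon> i * N * U / 2)"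
      by (simp add: field_simps)
    then show ?thesis using n2 by simp
  qed
  have "schouten (conf_metric \<epsilon> (\<lambda>x. \<Phi> (\<xi> x))) x $ i $ j = (u' ?t + (u ?t)\<^sup>2) * \<alpha> $ i * \<alpha> $ j
        - (if i = j then \<epsilon> i * N * (u ?t)\<^sup>2 / 2 else 0)" for i j
  proof (cases "i = j")
    case True
    then show ?thesis
      unfolding schouten_def scal ric g using cancel[of "u' ?t + (u ?t)\<^sup>2" "\<alpha> $ j" "\<alpha> $ j" j "(u ?t)\<^sup>2"]
      by (simp add: flat_metric_def add_diff_eq)
  next
    case False
    then show ?thesis
      unfolding schouten_def scal ric g using n2 by (simp add: flat_metric_def)
  qed
  then show ?thesis
    using False by (simp add: conf_schouten_def vec_eq_iff N_def)
qed

text \<open>The endomorphism has the eigenvalue \<open>s = - N \<Phi>\<^sup>2 u\<^sup>2 / 2\<close> with multiplicity \<open>n - 1\<close> and one further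
eigenvalue \<open>s + N \<Phi>\<^sup>2 (u' + u\<^sup>2)\<close>. In dimension \<open>n = 2 k\<close> the two binomial coefficients in \<open>\<sigma>\<^sub>k\<close>
agree, so that all terms without \<open>u'\<close> cancel. This is the special feature of the critical
dimension that makes the equation integrable.\<close>

lemma sigma_conf_schouten_ridge:
  fixes \<alpha> :: "real^'n::finite"
  assumes \<epsilon>: "\<And>i. \<epsilon> i = 1 \<or> \<epsilon> i = -1" and pos: "\<And>t. \<Phi> t > 0"
    and \<Phi>: "\<And>t. (\<Phi> has_real_derivative u t * \<Phi> t) (at t)"
    and u: "\<And>t. (u has_real_derivative u' t) (at t)"
    and n: "CARD('n) = 2 * k" "k \<ge> 1"
  defines "\<xi> \<equiv> basic_invariant \<alpha>" and "N \<equiv> flat_norm2 \<epsilon> \<alpha>"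
  shows "sigma k (matrix_inv (conf_metric \<epsilon> (\<lambda>x. \<Phi> (\<xi> x)) x) ** conf_schouten \<epsilon> (\<lambda>x. \<Phi> (\<xi> x)) x)
    = real k * b_coeff (2 * k) k * N ^ k * \<Phi> (\<xi> x) ^ (2 * k) * u (\<xi> x) ^ (2 * k - 2) * u' (\<xi> x)"
proof -
  let ?t = "\<xi> x"
  define s where "s = - (N * (\<Phi> ?t)\<^sup>2 * (u ?t)\<^sup>2 / 2)"
  define p where "p = (\<Phi> ?t)\<^sup>2 * (u' ?t + (u ?t)\<^sup>2)"
  have ee: "\<epsilon> i * \<epsilon> i = 1" for i using \<epsilon>[of i] by auto
  have inv: "matrix_inv (conf_metric \<epsilon> (\<lambda>x. \<Phi> (\<xi> x)) x) = (\<Phi> ?t)\<^sup>2 *\<^sub>R flat_metric \<epsilon>"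
    using pos[of ?t] by (intro matrix_inv_conf_metric \<epsilon>) simp
  have n2: "CARD('n) \<ge> 2" using n by simp
  have sch: "conf_schouten \<epsilon> (\<lambda>x. \<Phi> (\<xi> x)) x = (\<chi> i j. (u' ?t + (u ?t)\<^sup>2) * \<alpha> $ i * \<alpha> $ j
        - (if i = j then \<epsilon> i * N * (u ?t)\<^sup>2 / 2 else 0))"
    unfolding \<xi>_def N_def by (rule conf_schouten_ridge[OF \<epsilon> pos \<Phi> u n2])
  have M: "matrix_inv (conf_metric \<epsilon> (\<lambda>x. \<Phi> (\<xi> x)) x) ** conf_schouten \<epsilon> (\<lambda>x. \<Phi> (\<xi> x)) x
    = (\<chi> i j. (if i = j then s else 0) + (\<chi> i. p * \<epsilon> i * \<alpha> $ i) $ i * \<alpha> $ j)"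
  proof -
    show ?thesis
      unfolding inv sch by (auto simp: vec_eq_iff scalar_matrix_assoc[symmetric]
          flat_metric_mult_nth s_def p_def algebra_simps ee)
  qed
  have dot: "(\<Sum>i\<in>UNIV. (\<chi> i. p * \<epsilon> i * \<alpha> $ i) $ i * \<alpha> $ i) = p * N"
    by (simp add: N_def flat_norm2_def sum_distrib_left power2_eq_square mult_ac)
  define B where "B = real ((2 * k - 1) choose k)"
  have B: "B = real ((2 * k - 1) choose (k - 1))"
    unfolding B_def using binomial_symmetric[of k "2 * k - 1"] n by simp
  have Bk: "B * (- 1 / 2) ^ (k - 1) = real k * b_coeff (2 * k) k"
  proof -
    have "B = fact (2 * k - 1) / (fact k * fact (k - 1))"
      unfolding B_def using n by (subst binomial_fact) simp_all
    moreover have "fact k = real k * fact (k - 1)" using n by (simp add: fact_reduce)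
    moreover have "(- 1 / 2 :: real) ^ (k - 1) = (- 1) ^ (k - 1) / 2 ^ (k - 1)" by (rule power_divide)
    ultimately show ?thesis
      using n unfolding b_coeff_def by simp
  qed
  have "sigma k (matrix_inv (conf_metric \<epsilon> (\<lambda>x. \<Phi> (\<xi> x)) x) ** conf_schouten \<epsilon> (\<lambda>x. \<Phi> (\<xi> x)) x)
     = B * s ^ k + B * s ^ (k - 1) * (s + p * N)"
    unfolding M sigma_rank_one_update[OF n(2)] dot n(1) B_def[symmetric] B[symmetric] ..
  also have "s ^ k = s ^ (k - 1) * s" using n by (intro power_minus_mult[symmetric]) simp
  also have "B * (s ^ (k - 1) * s) + B * s ^ (k - 1) * (s + p * N) = B * s ^ (k - 1) * (2 * s + p * N)"
    by (simp add: algebra_simps)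
  also have "2 * s + p * N = N * (\<Phi> ?t)\<^sup>2 * u' ?t"
    by (simp add: s_def p_def algebra_simps)
  also have "s ^ (k - 1) = (- 1 / 2) ^ (k - 1) * (N ^ (k - 1) * \<Phi> ?t ^ (2 * k - 2) * u ?t ^ (2 * k - 2))"
  proof -
    have "s = (- 1 / 2) * (N * (\<Phi> ?t)\<^sup>2 * (u ?t)\<^sup>2)" by (simp add: s_def)
    moreover have "(z\<^sup>2) ^ (k - 1) = z ^ (2 * k - 2)" for z :: real
      by (simp add: power_mult[symmetric] right_diff_distrib')
    ultimately show ?thesis by (simp only: power_mult_distrib)
  qed
  also have "B * ((- 1 / 2) ^ (k - 1) * (N ^ (k - 1) * \<Phi> ?t ^ (2 * k - 2) * u ?t ^ (2 * k - 2))) * (N * (\<Phi> ?t)\<^sup>2 * u' ?t)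
    = (B * (- 1 / 2) ^ (k - 1)) * (N ^ (k - 1) * N) * (\<Phi> ?t ^ (2 * k - 2) * (\<Phi> ?t)\<^sup>2) * u ?t ^ (2 * k - 2) * u' ?t"
    by (simp add: mult_ac)
  also have "N ^ (k - 1) * N = N ^ k" using n by (intro power_minus_mult) simp
  also have "\<Phi> ?t ^ (2 * k - 2) * (\<Phi> ?t)\<^sup>2 = \<Phi> ?t ^ (2 * k)"
    using n by (intro power_eq_power_diff_2_times_square[symmetric]) simp
  finally show ?thesis unfolding Bk .
qed


section \<open>The ordinary differential equation for the profile\<close>

lemma slope_bounded_below_imp_negative:
  fixes g g' :: "real \<Rightarrow> real"
  assumes g: "\<And>t. (g has_real_derivative g' t) (at t)"
    and m: "m > 0" "\<And>t. t \<le> 0 \<Longrightarrow> g' t \<ge> m"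
  shows "\<exists>t. g t < 0"
proof -
  define a where "a = - (\<bar>g 0\<bar> + 1) / m"
  have a: "a < 0" using m(1) by (simp add: a_def field_simps)
  obtain z where z: "a < z" "z < 0" "g 0 - g a = (0 - a) * g' z"
    using MVT2[OF a g] by blast
  have "(0 - a) * m \<le> g 0 - g a"
    unfolding z(3) using a m(2)[of z] z by (intro mult_left_mono) auto
  moreover have "(0 - a) * m = \<bar>g 0\<bar> + 1" using m(1) by (simp add: a_def)
  ultimately show ?thesis by (intro exI[of _ a]) linarith
qed

text \<open>The two sides of the equation are the derivatives of \<open>u ^ (n - 1)\<close> and of \<open>A / \<Phi> ^ n\<close>, because
\<open>\<Phi>' = u \<Phi>\<close>. In this form nothing is divided by \<open>u\<close>, so the integral exists on the whole line, also
across possible zeros of \<open>u\<close>.\<close>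

lemma profile_first_integral:
  fixes \<Phi> u u' :: "real \<Rightarrow> real"
  assumes pos: "\<And>t. \<Phi> t > 0"
    and \<Phi>: "\<And>t. (\<Phi> has_real_derivative u t * \<Phi> t) (at t)"
    and u: "\<And>t. (u has_real_derivative u' t) (at t)"
    and ode: "\<And>t. (real n - 1) * u t ^ (n - 2) * u' t = - (real n * A * u t / \<Phi> t ^ n)"
    and n: "n \<ge> 2"
  shows "\<exists>c1. \<forall>t. u t ^ (n - 1) = A / \<Phi> t ^ n + c1"
proof -
  have "((\<lambda>t. u t ^ (n - 1) - A / \<Phi> t ^ n) has_real_derivative 0) (at t)" for t
  proof -
    have "((\<lambda>t. u t ^ (n - 1)) has_real_derivative (real n - 1) * u t ^ (n - 2) * u' t) (at t)"
      using DERIV_power[OF u, of "n - 1" t] n by (simp add: of_nat_diff numeral_2_eq_2 mult_ac)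
    moreover have "((\<lambda>t. A / \<Phi> t ^ n) has_real_derivative - (real n * A * u t / \<Phi> t ^ n)) (at t)"
    proof -
      have "\<Phi> t ^ n = \<Phi> t ^ (n - 1) * \<Phi> t" using n by (intro power_minus_mult[symmetric]) simp
      then show ?thesis using pos[of t]
        by (auto intro!: derivative_eq_intros \<Phi> simp: field_simps)
    qed
    ultimately have "((\<lambda>t. u t ^ (n - 1) - A / \<Phi> t ^ n) has_real_derivative
        (real n - 1) * u t ^ (n - 2) * u' t - (- (real n * A * u t / \<Phi> t ^ n))) (at t)"
      by (rule DERIV_diff)
    then show ?thesis unfolding ode by simp
  qed
  then have "u t ^ (n - 1) - A / \<Phi> t ^ n = u 0 ^ (n - 1) - A / \<Phi> 0 ^ n" for t
    using DERIV_isconst_all[of "\<lambda>t. u t ^ (n - 1) - A / \<Phi> t ^ n" t 0] by blast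
  then have "u t ^ (n - 1) = A / \<Phi> t ^ n + (u 0 ^ (n - 1) - A / \<Phi> 0 ^ n)" for t
    by (metis add.commute diff_add_cancel)
  then show ?thesis by blast
qed

text \<open>Follow the solution backwards in time. Then \<open>\<Phi>\<close> decreases, so \<open>1 / \<Phi> ^ n\<close> stays away from 0, and
a suitable positive function of \<open>u\<close> has slope bounded below by a positive constant for \<open>t \<le> 0\<close>, so
it becomes negative. That function is \<open>u ^ (n - 2)\<close> if \<open>A < 0\<close>. If \<open>A > 0\<close> then \<open>u\<close> blows up in finite
backward time, which is seen from \<open>1 / u\<close>.\<close>

lemma no_entire_increasing_profile:
  fixes \<Phi> u u' :: "real \<Rightarrow> real"
  assumes pos: "\<And>t. \<Phi> t > 0"
    and \<Phi>: "\<And>t. (\<Phi> has_real_derivative u t * \<Phi> t) (at t)"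
    and u: "\<And>t. (u has_real_derivative u' t) (at t)"
    and ode: "\<And>t. (real n - 1) * u t ^ (n - 2) * u' t = - (real n * A * u t / \<Phi> t ^ n)"
    and n: "n \<ge> 3" and A: "A \<noteq> 0" and u_pos: "\<And>t. u t > 0"
  shows False
proof -
  have mono: "\<Phi> t \<le> \<Phi> 0" if "t \<le> 0" for t
  proof (rule DERIV_nonneg_imp_nondecreasing[OF that])
    fix x show "\<exists>y. DERIV \<Phi> x :> y \<and> 0 \<le> y"
      using \<Phi>[of x] u_pos[of x] pos[of x] by (intro exI[of _ "u x * \<Phi> x"]) simp
  qed
  have wmono: "1 / \<Phi> 0 ^ n \<le> 1 / \<Phi> t ^ n" if "t \<le> 0" for t
    using mono[OF that] pos[of t] pos[of 0] by (intro divide_left_mono power_mono) auto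
  have n2: "n - 2 = Suc (n - 3)" using n by simp
  have red: "(real n - 1) * u t ^ (n - 3) * u' t = - (real n * A / \<Phi> t ^ n)" for t
  proof -
    have "u t * ((real n - 1) * u t ^ (n - 3) * u' t) = u t * (- (real n * A / \<Phi> t ^ n))"
      using ode[of t] unfolding n2 by (simp add: mult_ac)
    from mult_left_cancel[THEN iffD1, OF _ this] show ?thesis using u_pos[of t] by force
  qed
  show False
  proof (cases "A < 0")
    case True
    define K where "K = (real n - 2) * (real n * (- A)) / (real n - 1)"
    have K: "K > 0" using True n unfolding K_def by (intro divide_pos_pos mult_pos_pos) auto
    have deriv: "((\<lambda>t. u t ^ (n - 2)) has_real_derivative K * (1 / \<Phi> t ^ n)) (at t)" for t
    proof -
      have "((\<lambda>t. u t ^ (n - 2)) has_real_derivative (real n - 2) * u t ^ (n - 3) * u' t) (at t)"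
        using DERIV_power[OF u, of "n - 2" t] n by (simp add: of_nat_diff numeral_eq_Suc mult_ac)
      moreover have "(real n - 2) * u t ^ (n - 3) * u' t
          = (real n - 2) / (real n - 1) * ((real n - 1) * u t ^ (n - 3) * u' t)"
        using n by simp
      ultimately show ?thesis unfolding red by (simp add: K_def mult_ac)
    qed
    have slope: "K * (1 / \<Phi> 0 ^ n) \<le> K * (1 / \<Phi> t ^ n)" if "t \<le> 0" for t
      using wmono[OF that] K by (intro mult_left_mono) auto
    have "K * (1 / \<Phi> 0 ^ n) > 0" using K pos[of 0] by simp
    from slope_bounded_below_imp_negative[OF deriv this slope]
    obtain t where "u t ^ (n - 2) < 0" by blast
    then show False using zero_less_power[OF u_pos[of t], of "n - 2"] by linarith
  next
    case False
    then have A: "A > 0" using A by simp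
    obtain c1 where c1: "\<And>t. u t ^ (n - 1) = A / \<Phi> t ^ n + c1"
      using profile_first_integral[OF pos \<Phi> u ode] n by force
    define D where "D t = A / \<Phi> t ^ n" for t
    define K where "K = real n / (real n - 1)"
    have K: "K > 0" using n by (simp add: K_def)
    have Dpos: "D t > 0" for t using A pos[of t] by (simp add: D_def)
    have Dc: "D t + c1 > 0" for t using c1[of t] zero_less_power[OF u_pos[of t], of "n - 1"] by (simp add: D_def)
    have D0: "D 0 \<le> D t" if "t \<le> 0" for t
      using mult_left_mono[OF wmono[OF that], of A] A by (simp add: D_def)
    have deriv: "((\<lambda>t. 1 / u t) has_real_derivative K * (D t / (D t + c1))) (at t)" for t
    proof -
      have "u t ^ (n - 1) = u t ^ (n - 3) * (u t)\<^sup>2"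
      proof -
        have "n - 1 = (n - 3) + 2" using n by simp
        then show ?thesis by (metis power_add)
      qed
      moreover have "- u' t = K * D t / u t ^ (n - 3)"
      proof -
        have "((real n - 1) * u t ^ (n - 3)) * (- u' t) = real n * D t"
          using red[of t] by (simp add: D_def)
        moreover have "(real n - 1) * u t ^ (n - 3) \<noteq> 0" using u_pos[of t] n by simp
        ultimately have "- u' t = real n * D t / ((real n - 1) * u t ^ (n - 3))"
          by (metis nonzero_mult_div_cancel_left)
        then show ?thesis by (simp add: K_def)
      qed
      ultimately have "- u' t / (u t)\<^sup>2 = K * (D t / (D t + c1))"
        using c1[of t, folded D_def] by simp
      moreover have "((\<lambda>t. 1 / u t) has_real_derivative - u' t / (u t)\<^sup>2) (at t)"
        using u_pos[of t] by (auto intro!: derivative_eq_intros u simp: power2_eq_square)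
      ultimately show ?thesis by simp
    qed
    have slope: "K * min 1 (D 0 / (D 0 + c1)) \<le> K * (D t / (D t + c1))" if "t \<le> 0" for t
    proof (intro mult_left_mono)
      show "min 1 (D 0 / (D 0 + c1)) \<le> D t / (D t + c1)"
      proof (cases "c1 \<le> 0")
        case True
        then have "1 \<le> D t / (D t + c1)" using Dc[of t] by simp
        then show ?thesis by simp
      next
        case False
        then have "D 0 * c1 \<le> D t * c1" using D0[OF that] by (intro mult_right_mono) auto
        then have "D 0 / (D 0 + c1) \<le> D t / (D t + c1)"
          using Dc[of 0] Dc[of t] by (simp add: field_simps)
        then show ?thesis by simp
      qed
    qed (use K in simp)
    have "K * min 1 (D 0 / (D 0 + c1)) > 0" using K Dpos[of 0] Dc[of 0] by simp
    from slope_bounded_below_imp_negative[OF deriv this slope]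
    obtain t where "1 / u t < 0" by blast
    then show False using u_pos[of t] by simp
  qed
qed

text \<open>Dividing the equation by \<open>u\<close> at points where \<open>u \<noteq> 0\<close> gives
\<open>(n - 1) u ^ (n - 3) u' = - n A / \<Phi> ^ n\<close>. The left side would tend to 0 at a zero of \<open>u\<close>, since
\<open>n - 3 \<ge> 1\<close> and \<open>u'\<close> is continuous, but the right side would not. Hence zeros of \<open>u\<close> are never limits
of non-zeros, and \<open>u\<close> vanishes either everywhere or nowhere. If it vanishes nowhere, it has a
constant sign, and reversing time reduces the negative sign to the positive one.\<close>

lemma profile_constant_of_dim_gt_2:
  fixes \<Phi> u u' :: "real \<Rightarrow> real"
  assumes pos: "\<And>t. \<Phi> t > 0"
    and \<Phi>: "\<And>t. (\<Phi> has_real_derivative u t * \<Phi> t) (at t)"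
    and u: "\<And>t. (u has_real_derivative u' t) (at t)"
    and u': "continuous_on UNIV u'"
    and ode: "\<And>t. (real n - 1) * u t ^ (n - 2) * u' t = - (real n * A * u t / \<Phi> t ^ n)"
    and n: "n > 2" "even n" and A: "A \<noteq> 0"
  shows "u t = 0"
proof -
  have n4: "n \<ge> 4" using n by (cases "n = 3") auto
  then have n2: "n - 2 = Suc (n - 3)" by simp
  have cont: "continuous_on UNIV \<Phi>" "continuous_on UNIV u"
    using \<Phi> u by (auto intro!: continuous_at_imp_continuous_on DERIV_isCont)
  define h where "h t = (real n - 1) * u t ^ (n - 3) * u' t + real n * A / \<Phi> t ^ n" for t
  have hcont: "continuous_on UNIV h"
    unfolding h_def using pos by (intro continuous_intros cont u') (simp add: less_imp_neq[symmetric])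
  have h: "u t * h t = 0" for t
    using ode[of t] unfolding n2 h_def by (simp add: algebra_simps)
  have "{t. u t = 0} = {t. h t \<noteq> 0}"
  proof (intro Collect_cong iffI)
    fix t assume "u t = 0"
    then show "h t \<noteq> 0" using n4 A pos[of t] by (simp add: h_def power_0_left)
  next
    fix t assume "h t \<noteq> 0"
    then show "u t = 0" using h[of t] by simp
  qed
  then have "open {t. u t = 0}"
    using open_Collect_neq[OF hcont continuous_on_const[of UNIV 0]] by simp
  moreover have "closed {t. u t = 0}"
    using closed_Collect_eq[OF cont(2) continuous_on_const[of UNIV 0]] by simp
  ultimately have "{t. u t = 0} = {} \<or> {t. u t = 0} = UNIV"
    using clopen[of "{t. u t = 0}"] by simp
  moreover have False if zeros: "{t. u t = 0} = {}"
  proof -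
    have nz: "u t \<noteq> 0" for t using zeros by auto
    have "(\<forall>t. u t > 0) \<or> (\<forall>t. u t < 0)"
    proof (rule ccontr)
      assume "\<not> ?thesis"
      then obtain a b where "u a \<le> 0" "u b \<ge> 0" by (auto simp: not_less)
      moreover have "connected (range u)"
        by (rule connected_continuous_image[OF cont(2) connected_UNIV])
      ultimately have "0 \<in> range u" using connectedD_interval[of "range u" "u a" "u b" 0] by simp
      then show False using nz by force
    qed
    then show False
    proof
      assume "\<forall>t. u t > 0"
      then show False
        using no_entire_increasing_profile[OF pos \<Phi> u ode _ A] n by auto
    next
      assume neg: "\<forall>t. u t < 0"
      show False
      proof (rule no_entire_increasing_profile[of "\<lambda>t. \<Phi> (- t)" "\<lambda>t. - u (- t)" "\<lambda>t. u' (- t)" n "- A"])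
        show "((\<lambda>t. \<Phi> (- t)) has_real_derivative - u (- t) * \<Phi> (- t)) (at t)" for t
          using DERIV_chain2[OF \<Phi>[of "- t"] DERIV_minus[OF DERIV_ident]] by simp
        show "((\<lambda>t. - u (- t)) has_real_derivative u' (- t)) (at t)" for t
          using DERIV_minus[OF DERIV_chain2[OF u[of "- t"] DERIV_minus[OF DERIV_ident]]] by simp
        show "(real n - 1) * (- u (- t)) ^ (n - 2) * u' (- t) = - (real n * - A * - u (- t) / \<Phi> (- t) ^ n)" for t
          using ode[of "- t"] n by simp
      qed (use neg pos A n in auto)
    qed
  qed
  ultimately show ?thesis by auto
qed

text \<open>For \<open>A = 0\<close> the power \<open>u ^ (n - 1)\<close> is constant. For \<open>n = 2\<close> the function \<open>q = u \<Phi>\<^sup>2\<close> satisfies the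
linear equation \<open>q' = 2 c1 q\<close>.\<close>

lemma profile_dichotomy:
  fixes \<Phi> u u' :: "real \<Rightarrow> real"
  assumes pos: "\<And>t. \<Phi> t > 0"
    and \<Phi>: "\<And>t. (\<Phi> has_real_derivative u t * \<Phi> t) (at t)"
    and u: "\<And>t. (u has_real_derivative u' t) (at t)"
    and u': "continuous_on UNIV u'"
    and ode: "\<And>t. (real n - 1) * u t ^ (n - 2) * u' t = - (real n * A * u t / \<Phi> t ^ n)"
    and n: "n \<ge> 2" "even n"
  shows "(\<forall>t. u t = 0) \<or> (\<forall>t. u t \<noteq> 0) \<and> (n = 2 \<or> A = 0)"
proof -
  obtain c1 where c1: "\<And>t. u t ^ (n - 1) = A / \<Phi> t ^ n + c1"
    using profile_first_integral[OF pos \<Phi> u ode n(1)] by blast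
  consider "A = 0" | "n = 2" | "n > 2" "A \<noteq> 0" using n(1) by linarith
  then show ?thesis
  proof cases
    case 1
    have "u t = 0 \<longleftrightarrow> u t ^ (n - 1) = 0" for t using n by simp
    then have "u t = 0 \<longleftrightarrow> c1 = 0" for t unfolding c1 using 1 by simp
    then show ?thesis using 1 by blast
  next
    case 2
    define q where "q t = A + c1 * (\<Phi> t)\<^sup>2" for t
    have uq: "u t * (\<Phi> t)\<^sup>2 = q t" for t
      using c1[of t] pos[of t] 2 by (simp add: q_def field_simps)
    have "((\<lambda>t. q t * exp (- 2 * c1 * t)) has_real_derivative 0) (at t)" for t
    proof -
      have "(q has_real_derivative c1 * (2 * \<Phi> t * (u t * \<Phi> t))) (at t)"
        unfolding q_def[abs_def] by (auto intro!: derivative_eq_intros \<Phi>)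
      also have "c1 * (2 * \<Phi> t * (u t * \<Phi> t)) = 2 * c1 * q t"
        unfolding uq[symmetric] by (simp add: power2_eq_square)
      finally have "(q has_real_derivative 2 * c1 * q t) (at t)" .
      then show ?thesis by (auto intro!: derivative_eq_intros)
    qed
    then have "q t * exp (- 2 * c1 * t) = q s * exp (- 2 * c1 * s)" for t s
      using DERIV_isconst_all[of "\<lambda>t. q t * exp (- 2 * c1 * t)"] by blast
    then have "q t = 0 \<longleftrightarrow> q s = 0" for t s by (metis exp_not_eq_zero mult_eq_0_iff)
    moreover have "u t = 0 \<longleftrightarrow> q t = 0" for t using uq[of t] pos[of t] by auto
    ultimately show ?thesis using 2 by blast
  next
    case 3
    then show ?thesis using profile_constant_of_dim_gt_2[OF pos \<Phi> u u' ode _ n(2)] by blast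
  qed
qed

lemma inverse_of_profile:
  fixes \<Phi> \<Phi>' :: "real \<Rightarrow> real"
  assumes \<Phi>: "\<And>t. (\<Phi> has_real_derivative \<Phi>' t) (at t)" and nz: "\<And>t. \<Phi>' t \<noteq> 0"
  obtains Q where "\<And>t. Q (\<Phi> t) = t" "\<And>t. (Q has_real_derivative 1 / \<Phi>' t) (at (\<Phi> t))"
proof -
  have ne: "\<Phi> a \<noteq> \<Phi> b" if ab: "a < b" for a b
  proof
    assume "\<Phi> a = \<Phi> b"
    moreover obtain z where "\<Phi> b - \<Phi> a = (b - a) * \<Phi>' z"
      using MVT2[OF ab \<Phi>] by blast
    ultimately show False using nz[of z] ab by simp
  qed
  have "inj \<Phi>" by (rule linorder_injI) (rule ne)
  then have inv: "inv \<Phi> (\<Phi> t) = t" for t by simp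
  have "(inv \<Phi> has_derivative (*) (1 / \<Phi>' t)) (at (\<Phi> t))" for t
  proof (rule has_derivative_inverse_strong[where f = \<Phi> and x = t, OF open_UNIV UNIV_I])
    show "continuous_on UNIV \<Phi>"
      using \<Phi> by (auto intro!: continuous_at_imp_continuous_on DERIV_isCont)
    show "(\<Phi> has_derivative (*) (\<Phi>' t)) (at t)"
      using \<Phi>[of t] by (simp add: has_field_derivative_def)
    show "(*) (\<Phi>' t) \<circ> (*) (1 / \<Phi>' t) = id" using nz[of t] by (auto simp: fun_eq_iff)
  qed (rule inv)
  then show thesis using that[of "inv \<Phi>"] inv by (simp add: has_field_derivative_def)
qed


section \<open>Steady solitons with ridge profiles\<close>

text \<open>Take \<open>i\<close> with \<open>\<alpha> $ i \<noteq> 0\<close> and some \<open>j \<noteq> i\<close>. If \<open>\<alpha> $ j \<noteq> 0\<close>, the entry at \<open>(i, j)\<close> forces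
\<open>p = 0\<close>; otherwise the entry at \<open>(j, j)\<close> forces \<open>q = 0\<close>, and then the one at \<open>(i, i)\<close> forces \<open>p = 0\<close>.\<close>

lemma rank_one_eq_diagonal_imp_zero:
  fixes \<alpha> :: "real^'n::finite"
  assumes \<epsilon>: "\<And>i. \<epsilon> i \<noteq> 0" and n: "CARD('n) \<ge> 2" and \<alpha>: "\<alpha> \<noteq> 0"
    and eq: "\<And>i j. p * \<alpha> $ i * \<alpha> $ j = (if i = j then \<epsilon> i * q else 0)"
  shows "p = 0" and "q = 0"
proof -
  obtain i where i: "\<alpha> $ i \<noteq> 0" using \<alpha> by (metis vec_eq_iff zero_index)
  have "(UNIV :: 'n set) \<noteq> {i}"
  proof
    assume "(UNIV :: 'n set) = {i}"
    then have "CARD('n) = card {i}" by simp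
    then show False using n by simp
  qed
  then obtain j where j: "j \<noteq> i" by auto
  show "p = 0"
  proof (cases "\<alpha> $ j = 0")
    case False
    then show ?thesis using eq[of i j] i j by auto
  next
    case True
    then have "q = 0" using eq[of j j] \<epsilon>[of j] by simp
    then show ?thesis using eq[of i i] i by simp
  qed
  then show "q = 0" using eq[of i i] \<epsilon>[of i] by simp
qed

text \<open>The soliton equation equates a multiple of \<open>\<alpha> \<alpha>\<^sup>T\<close> with a multiple of the flat metric, so both
coefficients vanish. These are the two scalar equations; a factor \<open>flat_norm2 \<epsilon> \<alpha> \<noteq> 0\<close> has been
cancelled in the second one.\<close>

lemma steady_ridge_soliton_equations:
  fixes \<alpha> :: "real^'n::finite"
  assumes \<epsilon>: "\<And>i. \<epsilon> i = 1 \<or> \<epsilon> i = -1" and pos: "\<And>t. \<Phi> t > 0"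
    and \<Phi>: "\<And>t. (\<Phi> has_real_derivative u t * \<Phi> t) (at t)"
    and u: "\<And>t. (u has_real_derivative u' t) (at t)"
    and F: "\<And>t. (F has_real_derivative F' t) (at t)"
    and F': "\<And>t. (F' has_real_derivative F'' t) (at t)"
    and n: "CARD('n) = 2 * k"
    and N: "flat_norm2 \<epsilon> \<alpha> \<noteq> 0"
    and soliton: "steady_gradient_Yamabe_soliton k \<epsilon>
       (\<lambda>x. \<Phi> (basic_invariant \<alpha> x)) (\<lambda>x. F (basic_invariant \<alpha> x))"
  shows "F'' t + 2 * u t * F' t = 0"
    and "- (u t * F' t) = (2 * real k - 1) * (2 * real k * b_coeff (2 * k) k)
          * flat_norm2 \<epsilon> \<alpha> ^ (k - 1) * \<Phi> t ^ (2 * k - 2) * u t ^ (2 * k - 2) * u' t"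
proof -
  let ?N = "flat_norm2 \<epsilon> \<alpha>"
  have k: "k \<ge> 1" using soliton by (simp add: gradient_Yamabe_soliton_def)
  have \<alpha>: "\<alpha> \<noteq> 0" using N by (auto simp: flat_norm2_def)
  have \<epsilon>0: "\<epsilon> i \<noteq> 0" for i using \<epsilon>[of i] by auto
  define x where "x = (t / (\<alpha> \<bullet> \<alpha>)) *\<^sub>R \<alpha>"
  have x: "basic_invariant \<alpha> x = t" unfolding x_def by (rule basic_invariant_section[OF \<alpha>])
  define \<sigma> where "\<sigma> = real k * b_coeff (2 * k) k * ?N ^ k * \<Phi> t ^ (2 * k) * u t ^ (2 * k - 2) * u' t"
  have "hessian (conf_metric \<epsilon> (\<lambda>x. \<Phi> (basic_invariant \<alpha> x))) (\<lambda>x. F (basic_invariant \<alpha> x)) x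
     = (2 * (2 * real k - 1) * \<sigma>) *\<^sub>R conf_metric \<epsilon> (\<lambda>x. \<Phi> (basic_invariant \<alpha> x)) x"
    using soliton sigma_conf_schouten_ridge[where \<alpha> = \<alpha> and x = x, OF \<epsilon> pos \<Phi> u n k]
    unfolding gradient_Yamabe_soliton_def by (simp add: \<sigma>_def x n)
  then have entry: "hessian (conf_metric \<epsilon> (\<lambda>x. \<Phi> (basic_invariant \<alpha> x))) (\<lambda>x. F (basic_invariant \<alpha> x)) x $ i $ j
     = 2 * (2 * real k - 1) * \<sigma> * (1 / (\<Phi> t)\<^sup>2 * (if i = j then \<epsilon> i else 0))" for i j
    by (simp add: conf_metric_def flat_metric_def x)
  have eq: "(F'' t + 2 * u t * F' t) * \<alpha> $ i * \<alpha> $ j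
       = (if i = j then \<epsilon> i * (?N * u t * F' t + 2 * (2 * real k - 1) * \<sigma> / (\<Phi> t)\<^sup>2) else 0)" for i j
    using entry[of i j] unfolding hessian_ridge[OF \<epsilon> pos \<Phi> F F'] x
    by (cases "i = j") (simp_all add: distrib_left mult_ac diff_eq_eq)
  have "CARD('n) \<ge> 2" using n k by simp
  note zero = rank_one_eq_diagonal_imp_zero[OF \<epsilon>0 this \<alpha> eq]
  show "F'' t + 2 * u t * F' t = 0" by (rule zero(1))
  have "?N * u t * F' t + 2 * (2 * real k - 1) * \<sigma> / (\<Phi> t)\<^sup>2 = 0" by (rule zero(2))
  moreover have "2 * (2 * real k - 1) * \<sigma> / (\<Phi> t)\<^sup>2 = ?N * ((2 * real k - 1) * (2 * real k * b_coeff (2 * k) k)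
          * ?N ^ (k - 1) * \<Phi> t ^ (2 * k - 2) * u t ^ (2 * k - 2) * u' t)"
  proof -
    have "?N ^ k = ?N ^ (k - 1) * ?N" using k by (intro power_minus_mult[symmetric]) simp
    moreover have "\<Phi> t ^ (2 * k) = \<Phi> t ^ (2 * k - 2) * (\<Phi> t)\<^sup>2"
      using k by (intro power_eq_power_diff_2_times_square) simp
    ultimately show ?thesis using pos[of t] by (simp add: \<sigma>_def)
  qed
  ultimately have "?N * (u t * F' t + (2 * real k - 1) * (2 * real k * b_coeff (2 * k) k)
          * ?N ^ (k - 1) * \<Phi> t ^ (2 * k - 2) * u t ^ (2 * k - 2) * u' t) = 0"
    by (simp add: algebra_simps)
  then show "- (u t * F' t) = (2 * real k - 1) * (2 * real k * b_coeff (2 * k) k)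
          * ?N ^ (k - 1) * \<Phi> t ^ (2 * k - 2) * u t ^ (2 * k - 2) * u' t"
    using N by (simp add: eq_neg_iff_add_eq_0 add.commute)
qed

text \<open>The function \<open>Q\<close> in the implicit equation is the inverse function of \<open>\<Phi>\<close>. As \<open>n - 1\<close> is odd, the
first integral determines \<open>\<Phi>' = u \<Phi>\<close> as a root without any choice of sign.\<close>

lemma nonconstant_solutionI:
  fixes \<Phi> F u :: "real \<Rightarrow> real"
  assumes pos: "\<And>t. \<Phi> t > 0"
    and \<Phi>: "\<And>t. (\<Phi> has_real_derivative u t * \<Phi> t) (at t)"
    and F: "\<And>t. (F has_real_derivative c / (\<Phi> t)\<^sup>2) (at t)"
    and u: "\<And>t. u t ^ (n - 1) = c / (b_coeff n k * (real n)\<^sup>2) / \<Phi> t ^ n + c1"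
    and nz: "\<And>t. u t \<noteq> 0"
    and n: "n \<ge> 2" "even n"
  shows "nonconstant_solution n k \<Phi> F"
proof -
  define R where "R v = c / (b_coeff n k * (real n)\<^sup>2 * v) + c1 * v ^ (n - 1)" for v
  have nz': "u t * \<Phi> t \<noteq> 0" for t using nz[of t] pos[of t] by simp
  have R: "R (\<Phi> t) = (u t * \<Phi> t) ^ (n - 1)" for t
  proof -
    have "\<Phi> t ^ n = \<Phi> t ^ (n - 1) * \<Phi> t" using n by (intro power_minus_mult[symmetric]) simp
    then show ?thesis
      unfolding power_mult_distrib u R_def using pos[of t] by (simp add: distrib_right)
  qed
  have "odd (n - 1)" using n by simp
  then have root: "root (n - 1) (R (\<Phi> t)) = u t * \<Phi> t" for t
    unfolding R by (rule odd_real_root_power_cancel)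
  obtain Q where Q: "\<And>t. Q (\<Phi> t) = t"
      "\<And>t. (Q has_real_derivative 1 / (u t * \<Phi> t)) (at (\<Phi> t))"
    using inverse_of_profile[OF \<Phi> nz'] by blast
  have "\<forall>t. R (\<Phi> t) \<noteq> 0 \<and> (Q has_real_derivative 1 / root (n - 1) (R (\<Phi> t))) (at (\<Phi> t))
      \<and> Q (\<Phi> t) = t + 0"
    unfolding root using Q nz' by (simp add: R)
  moreover have "\<forall>t. (F has_real_derivative c / (\<Phi> t)\<^sup>2) (at t) \<and> F t = F t + 0"
    using F by simp
  moreover have "\<forall>t. deriv \<Phi> t \<noteq> 0" using DERIV_imp_deriv[OF \<Phi>] nz' by simp
  ultimately show ?thesis
    unfolding nonconstant_solution_def Let_def R_def by blast
qed

theorem theorem1p5: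
  fixes \<epsilon> :: "'n::finite \<Rightarrow> real"
    and \<phi> f :: "real^'n \<Rightarrow> real"
    and \<alpha> :: "real^'n"
    and n k :: nat
  assumes dim: "n = CARD('n)" "n \<ge> 2" "n = 2 * k"
    and signature: "\<And>i. \<epsilon> i = 1 \<or> \<epsilon> i = -1"
    and conformal_factor: "smooth \<phi>" "\<And>x. \<phi> x > 0"
    and soliton: "steady_gradient_Yamabe_soliton k \<epsilon> \<phi> f"
    and non_null: "flat_norm2 \<epsilon> \<alpha> \<noteq> 0"
  shows "translation_invariant \<alpha> \<phi> \<and> translation_invariant \<alpha> f \<longleftrightarrow>
    (\<exists>\<Phi> F. (\<forall>x. \<phi> x = \<Phi> (basic_invariant \<alpha> x)) \<and>
           (\<forall>x. f x = F (basic_invariant \<alpha> x)) \<and>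
           (constant_solution \<Phi> F \<or> nonconstant_solution n k \<Phi> F))"
proof
  assume "translation_invariant \<alpha> \<phi> \<and> translation_invariant \<alpha> f"
  then obtain \<Phi> F where \<phi>: "\<phi> = (\<lambda>x. \<Phi> (basic_invariant \<alpha> x))"
    and f: "f = (\<lambda>x. F (basic_invariant \<alpha> x))"
    unfolding translation_invariant_def by (metis ext)
  have \<alpha>: "\<alpha> \<noteq> 0" using non_null by (auto simp: flat_norm2_def)
  have pos: "\<Phi> t > 0" for t
    using conformal_factor(2)[of "(t / (\<alpha> \<bullet> \<alpha>)) *\<^sub>R \<alpha>"]
    by (simp add: \<phi> basic_invariant_section[OF \<alpha>])
  have "smooth f" using soliton by (simp add: gradient_Yamabe_soliton_def)
  have F_diff: "(deriv ^^ m) F differentiable (at t)" for m t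
    using smooth_ridge_profile[OF \<alpha>] \<open>smooth f\<close> unfolding f by blast
  have \<Phi>_diff: "(deriv ^^ m) \<Phi> differentiable (at t)" for m t
    using smooth_ridge_profile[OF \<alpha>] conformal_factor(1) unfolding \<phi> by blast
  have F: "(F has_real_derivative deriv F t) (at t)" for t
    using F_diff[of 0 t] by (simp add: DERIV_deriv_iff_real_differentiable)
  have F': "(deriv F has_real_derivative deriv (deriv F) t) (at t)" for t
    using F_diff[of 1 t] by (simp add: DERIV_deriv_iff_real_differentiable)
  have D\<Phi>: "(\<Phi> has_real_derivative deriv \<Phi> t) (at t)"
       "(deriv \<Phi> has_real_derivative deriv (deriv \<Phi>) t) (at t)"
       "(deriv (deriv \<Phi>) has_real_derivative deriv (deriv (deriv \<Phi>)) t) (at t)" for t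
    using \<Phi>_diff[of 0 t] \<Phi>_diff[of 1 t] \<Phi>_diff[of 2 t]
    by (simp_all add: DERIV_deriv_iff_real_differentiable numeral_2_eq_2)
  \<comment> \<open>The logarithmic derivative is the variable in which the curvature takes its simplest form.\<close>
  define u where "u t = deriv \<Phi> t / \<Phi> t" for t
  define u' where "u' t = (deriv (deriv \<Phi>) t * \<Phi> t - deriv \<Phi> t * deriv \<Phi> t) / (\<Phi> t * \<Phi> t)" for t
  have \<Phi>: "(\<Phi> has_real_derivative u t * \<Phi> t) (at t)" for t
    using D\<Phi>(1)[of t] pos[of t] by (simp add: u_def)
  have u: "(u has_real_derivative u' t) (at t)" for t
    unfolding u_def[abs_def] u'_def using pos[of t] by (intro DERIV_divide D\<Phi>) simp
  have u'_cont: "continuous_on UNIV u'"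
  proof -
    have "continuous_on UNIV \<Phi>" "continuous_on UNIV (deriv \<Phi>)" "continuous_on UNIV (deriv (deriv \<Phi>))"
      using D\<Phi> by (auto intro!: continuous_at_imp_continuous_on DERIV_isCont)
    then show ?thesis unfolding u'_def[abs_def]
      using pos by (intro continuous_intros) (auto simp: less_imp_neq[symmetric])
  qed
  let ?N = "flat_norm2 \<epsilon> \<alpha>"
  have card: "CARD('n) = 2 * k" using dim by simp
  note eqs = steady_ridge_soliton_equations[OF signature pos \<Phi> u F F' card non_null soliton[unfolded \<phi> f]]
  have "((\<lambda>t. deriv F t * (\<Phi> t)\<^sup>2) has_real_derivative 0) (at t)" for t
  proof -
    have "((\<lambda>t. deriv F t * (\<Phi> t)\<^sup>2) has_real_derivative (deriv (deriv F) t + 2 * u t * deriv F t) * (\<Phi> t)\<^sup>2) (at t)"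
      by (auto intro!: derivative_eq_intros \<Phi> F' simp: algebra_simps power2_eq_square)
    then show ?thesis unfolding eqs(1) by simp
  qed
  then obtain c where c: "deriv F t * (\<Phi> t)\<^sup>2 = c" for t
    using DERIV_isconst_all[of "\<lambda>t. deriv F t * (\<Phi> t)\<^sup>2"] by metis
  have F'c: "deriv F t = c / (\<Phi> t)\<^sup>2" for t using c[of t] pos[of t] by (simp add: field_simps)
  define M where "M = ?N ^ (k - 1)"
  define A where "A = c / (b_coeff n k * (real n)\<^sup>2 * M)"
  have M: "M \<noteq> 0" using non_null by (simp add: M_def)
  have b: "b_coeff n k \<noteq> 0" by (simp add: b_coeff_def)
  have ode: "(real n - 1) * u t ^ (n - 2) * u' t = - (real n * A * u t / \<Phi> t ^ n)" for t
  proof -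
    have "\<Phi> t ^ n = \<Phi> t ^ (n - 2) * (\<Phi> t)\<^sup>2"
      by (rule power_eq_power_diff_2_times_square[OF dim(2)])
    moreover have "- (u t * (c / (\<Phi> t)\<^sup>2)) = (real n - 1) * (real n * b_coeff n k) * M * \<Phi> t ^ (n - 2) * u t ^ (n - 2) * u' t"
      using eqs(2)[of t] unfolding F'c M_def by (simp add: dim(3))
    ultimately show ?thesis
      using pos[of t] M b dim(2) unfolding A_def by (simp add: field_simps power2_eq_square)
  qed
  have "even n" unfolding dim(3) by simp
  note n = dim(2) this
  have "constant_solution \<Phi> F \<or> nonconstant_solution n k \<Phi> F"
    using profile_dichotomy[OF pos \<Phi> u u'_cont ode n]
  proof
    assume u0: "\<forall>t. u t = 0"
    have d: "deriv \<Phi> t = 0" for t using u0[rule_format, of t] pos[of t] by (simp add: u_def)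
    have "(\<Phi> has_real_derivative 0) (at t)" for t using D\<Phi>(1)[of t] by (simp add: d)
    then have const: "\<Phi> t = \<Phi> 0" for t by (intro DERIV_isconst_all[rule_format] allI)
    have "\<forall>t. ((\<lambda>t. F t - c / (\<Phi> 0)\<^sup>2 * t) has_real_derivative 0) (at t)"
    proof
      fix t
      show "((\<lambda>t. F t - c / (\<Phi> 0)\<^sup>2 * t) has_real_derivative 0) (at t)"
        using DERIV_diff[OF F[of t] DERIV_cmult[OF DERIV_ident, of "c / (\<Phi> 0)\<^sup>2" t]]
        unfolding F'c const[of t] by simp
    qed
    from DERIV_isconst_all[OF this]
    have affine: "F t - c / (\<Phi> 0)\<^sup>2 * t = F 0 - c / (\<Phi> 0)\<^sup>2 * 0" for t .
    have "F t = c / (\<Phi> 0)\<^sup>2 * t + F 0" for t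
      using affine[of t] by linarith
    then have "\<exists>c d c1. c1 > 0 \<and> (\<forall>t. \<Phi> t = c1) \<and> (\<forall>t. F t = c * t + d)"
      using const pos[of 0] by (intro exI[of _ "c / (\<Phi> 0)\<^sup>2"] exI[of _ "F 0"] exI[of _ "\<Phi> 0"]) (intro conjI allI)
    then show ?thesis using d unfolding constant_solution_def by blast
  next
    assume nz: "(\<forall>t. u t \<noteq> 0) \<and> (n = 2 \<or> A = 0)"
    \<comment> \<open>The factor \<open>M\<close> disappears because either it is an empty power or \<open>c = 0\<close>.\<close>
    have A: "A = c / (b_coeff n k * (real n)\<^sup>2)"
      using nz
    proof (elim conjE disjE)
      assume "n = 2"
      then have "M = 1" using dim by (simp add: M_def)
      then show ?thesis by (simp add: A_def)
    next
      assume "A = 0"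
      then have "c = 0" using M b dim(2) by (simp add: A_def)
      then show ?thesis by (simp add: A_def)
    qed
    obtain c1 where "\<forall>t. u t ^ (n - 1) = A / \<Phi> t ^ n + c1"
      using profile_first_integral[OF pos \<Phi> u ode n(1)] by blast
    then have "nonconstant_solution n k \<Phi> F"
      using nz F n by (intro nonconstant_solutionI[OF pos \<Phi>]) (auto simp: A F'c)
    then show ?thesis ..
  qed
  then show "\<exists>\<Phi> F. (\<forall>x. \<phi> x = \<Phi> (basic_invariant \<alpha> x)) \<and>
           (\<forall>x. f x = F (basic_invariant \<alpha> x)) \<and>
           (constant_solution \<Phi> F \<or> nonconstant_solution n k \<Phi> F)"
    unfolding \<phi> f by blast
next
  assume "\<exists>\<Phi> F. (\<forall>x. \<phi> x = \<Phi> (basic_invariant \<alpha> x)) \<and>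
           (\<forall>x. f x = F (basic_invariant \<alpha> x)) \<and>
           (constant_solution \<Phi> F \<or> nonconstant_solution n k \<Phi> F)"
  then show "translation_invariant \<alpha> \<phi> \<and> translation_invariant \<alpha> f"
    unfolding translation_invariant_def by blast
qed

end
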